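(* Let $\mathcal I$ be a multinomial inference family or a fixed-mean Gaussian inference family (as in the context), let $\eta\in L(\mathcal I)$ with pseudomarginals $\{b_\alpha,b_i\}$, and let $u^\alpha_{i\to j}=\mathrm{Var}_{b_j}(\phi_j)^{-1}\mathrm{Cov}_{b_\alpha}(\phi_j,\phi_i)$. If every eigenvalue of $\mathcal M(\mathbf u)$ lies in $\mathbb{C}\setminus[1,\infty)$, then the Hessian $\nabla^2F_{\mathrm B}(\eta)$ of the Bethe free energy is positive definite.
   Context: Hypergraph $H=(V,F)$ (finite $V$, finite collection $F$ of nonempty subsets), $d_i=|\{\alpha:i\in\alpha\}|$; $\vec E=\{(\alpha\to i):i\in\alpha\}$, $s(\alpha\to i)=\alpha$, $t(\alpha\to i)=i$; $e'\rightharpoonup e$ iff $t(e')\in s(e)$, $t(e')\ne t(e)$, $s(e')\ne s(e)$. $\mathcal M(\mathbf u)$ acts on $\bigoplus_{e}\mathbb{R}^{r_{t(e)}}$ by $(\mathcal M(\mathbf u)f)(e)=\sum_{e':e'\rightharpoonup e}u^{s(e)}_{t(e')\to t(e)}f(e')$. Multinomial family: each $\mathcal X_i$ is a finite set $\{1,\dots,N_i\}$, $\phi_i(x)=(\mathbf 1[x=k])_{k=1}^{N_i-1}$; $L$ is the set of families $\{b_\alpha,b_i\}$ of strictly positive probability functions on $\mathcal X_\alpha=\prod_{i\in\alpha}\mathcal X_i$ and on $\mathcal X_i$ such that the $x_i$-marginal of $b_\alpha$ is $b_i$; for given positive functions $\Psi_\alpha$, $F_{\mathrm B}=-\sum_\alpha\sum_{x_\alpha}b_\alpha\log\Psi_\alpha+\sum_\alpha\sum_{x_\alpha}b_\alpha\log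 b_\alpha+\sum_i(1-d_i)\sum_{x_i}b_i\log b_i$, viewed as a function on the relatively open convex set $L$ (Hessian with respect to affine coordinates of its affine hull). Fixed-mean Gaussian family: $H$ is a simple graph $G=(V,E)$ (factors are the edges $\{i,j\}$), $\mu\in\mathbb{R}^V$ fixed, $\mathcal X_i=\mathbb{R}$, $\phi_i(x_i)=(x_i-\mu_i)^2$; $L=\{(\eta_{ii})_{i\in V},(\eta_{ij})_{ij\in E}:\eta_{ii}>0,\ \eta_{ii}\eta_{jj}-\eta_{ij}^2>0\}$; $b_{ij}$ is the Gaussian with mean $(\mu_i,\mu_j)$ and covariance $\begin{pmatrix}\eta_{ii}&\eta_{ij}\\\eta_{ij}&\eta_{jj}\end{pmatrix}$, $b_i$ its marginal; $F_{\mathrm B}(\eta)=\ell(\eta)-\tfrac12\sum_{ij\in E}\log(\eta_{ii}\eta_{jj}-\eta_{ij}^2)-\tfrac12\sum_i(1-d_i)\log\eta_{ii}$ up to an additive constant, $\ell$ an arbitrary linear function. *)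

theory Defs
  imports "HOL-Probability.Probability" "HOL-Library.Function_Algebras"
begin

(* Pointwise scalar multiplication on function spaces, so that families of pseudomarginals
   and covariance parameters are points of a real vector space and the library's affine hull
   and linear maps apply to them. *)

instantiation "fun" :: (type, scaleR) scaleR
begin

definition scaleR_fun_def: "c *\<^sub>R f = (\<lambda>x. c *\<^sub>R f x)"

instance ..

end

instance "fun" :: (type, real_vector) real_vector
  by standard (auto simp: scaleR_fun_def fun_eq_iff scaleR_add_right scaleR_add_left)


section \<open>Hypergraphs and the operator on directed edges\<close>

definition hypergraph :: "'v set \<Rightarrow> 'v set set \<Rightarrow> bool" where
  "hypergraph V F \<longleftrightarrow> finite V \<and> (\<forall>\<alpha>\<in>F. \<alpha> \<noteq> {} \<and> \<alpha> \<subseteq> V)"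

definition simple_graph :: "'v set \<Rightarrow> 'v set set \<Rightarrow> bool" where
  "simple_graph V E \<longleftrightarrow> finite V \<and> (\<forall>\<alpha>\<in>E. \<alpha> \<subseteq> V \<and> card \<alpha> = 2)"

definition hdegree :: "'v set set \<Rightarrow> 'v \<Rightarrow> nat" where
  "hdegree F i = card {\<alpha>\<in>F. i \<in> \<alpha>}"

(* The directed edge \<alpha> \<rightarrow> i is the pair (\<alpha>, i): its source is fst, its target snd. *)

type_synonym 'v dedge = "'v set \<times> 'v"

definition dedges :: "'v set set \<Rightarrow> 'v dedge set" where
  "dedges F = {(\<alpha>, i). \<alpha> \<in> F \<and> i \<in> \<alpha>}"

definition feeds :: "'v dedge \<Rightarrow> 'v dedge \<Rightarrow> bool"  (infix "\<rightharpoonup>" 50) where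
  "e' \<rightharpoonup> e \<longleftrightarrow> snd e' \<in> fst e \<and> snd e' \<noteq> snd e \<and> fst e' \<noteq> fst e"

(* The direct sum over the directed edges e of K^(r (t e)), for K the reals or the complex
   numbers.  Vector components are numbered from 1; all values outside the index range
   are 0. *)

definition edge_space :: "'v set set \<Rightarrow> ('v \<Rightarrow> nat) \<Rightarrow> ('v dedge \<Rightarrow> nat \<Rightarrow> 'a::zero) set" where
  "edge_space F r = {f. \<forall>e k. \<not> (e \<in> dedges F \<and> k \<in> {1..r (snd e)}) \<longrightarrow> f e k = 0}"

(* u \<alpha> i j k l is the (k,l) entry of the r j by r i matrix with superscript \<alpha> and subscript
   i \<rightarrow> j.  At type real this is the operator M(u), at type complex its complexification. *)

definition edge_op ::
  "'v set set \<Rightarrow> ('v \<Rightarrow> nat) \<Rightarrow> ('v set \<Rightarrow> 'v \<Rightarrow> 'v \<Rightarrow> nat \<Rightarrow> nat \<Rightarrow> real) \<Rightarrow>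
   ('v dedge \<Rightarrow> nat \<Rightarrow> 'a::real_vector) \<Rightarrow> 'v dedge \<Rightarrow> nat \<Rightarrow> 'a" where
  "edge_op F r u f = (\<lambda>e k.
     if e \<in> dedges F \<and> k \<in> {1..r (snd e)}
     then \<Sum>e' | e' \<in> dedges F \<and> e' \<rightharpoonup> e.
            \<Sum>l = 1..r (snd e'). u (fst e) (snd e') (snd e) k l *\<^sub>R f e' l
     else 0)"

definition edge_op_eigenvalue ::
  "'v set set \<Rightarrow> ('v \<Rightarrow> nat) \<Rightarrow> ('v set \<Rightarrow> 'v \<Rightarrow> 'v \<Rightarrow> nat \<Rightarrow> nat \<Rightarrow> real) \<Rightarrow> complex \<Rightarrow> bool" where
  "edge_op_eigenvalue F r u z \<longleftrightarrow>
     (\<exists>f \<in> edge_space F r. f \<noteq> (\<lambda>e k. 0) \<and> edge_op F r u f = (\<lambda>e k. z * f e k))"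


section \<open>Covariances and the matrices u\<close>

definition cov :: "'a measure \<Rightarrow> ('a \<Rightarrow> real) \<Rightarrow> ('a \<Rightarrow> real) \<Rightarrow> real" where
  "cov M f g = (LINT x|M. (f x - (LINT y|M. f y)) * (g x - (LINT y|M. g y)))"

definition is_matrix_inverse ::
  "nat \<Rightarrow> (nat \<Rightarrow> nat \<Rightarrow> real) \<Rightarrow> (nat \<Rightarrow> nat \<Rightarrow> real) \<Rightarrow> bool" where
  "is_matrix_inverse n A B \<longleftrightarrow>
     (\<forall>k\<in>{1..n}. \<forall>l\<in>{1..n}.
        (\<Sum>m = 1..n. A k m * B m l) = (if k = l then 1 else 0) \<and>
        (\<Sum>m = 1..n. B k m * A m l) = (if k = l then 1 else 0))"

(* Only the entries with indices in {1..n} are meaningful; for an invertible matrix they are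
   uniquely determined. *)

definition matrix_inverse :: "nat \<Rightarrow> (nat \<Rightarrow> nat \<Rightarrow> real) \<Rightarrow> nat \<Rightarrow> nat \<Rightarrow> real" where
  "matrix_inverse n A = (SOME B. is_matrix_inverse n A B)"

(* Var j is the covariance matrix of phi_j under b_j, and C \<alpha> j i the r j by r i matrix
   of covariances of phi_j with phi_i under b_\<alpha>. *)

definition edge_weights ::
  "('v \<Rightarrow> nat) \<Rightarrow> ('v \<Rightarrow> nat \<Rightarrow> nat \<Rightarrow> real) \<Rightarrow> ('v set \<Rightarrow> 'v \<Rightarrow> 'v \<Rightarrow> nat \<Rightarrow> nat \<Rightarrow> real) \<Rightarrow>
   'v set \<Rightarrow> 'v \<Rightarrow> 'v \<Rightarrow> nat \<Rightarrow> nat \<Rightarrow> real" where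
  "edge_weights r Var C \<alpha> i j k l =
     (\<Sum>m = 1..r j. matrix_inverse (r j) (Var j) k m * C \<alpha> j i m l)"


section \<open>Hessians in affine coordinates\<close>

(* R^m, as the sequences vanishing from index m on. *)

definition coord_space :: "nat \<Rightarrow> (nat \<Rightarrow> real) set" where
  "coord_space m = {t. \<forall>i\<ge>m. t i = 0}"

definition affine_map :: "nat \<Rightarrow> 'p::real_vector \<Rightarrow> (nat \<Rightarrow> 'p) \<Rightarrow> (nat \<Rightarrow> real) \<Rightarrow> 'p" where
  "affine_map m p w t = p + (\<Sum>i<m. t i *\<^sub>R w i)"

definition affine_coordinates :: "'p::real_vector set \<Rightarrow> nat \<Rightarrow> 'p \<Rightarrow> (nat \<Rightarrow> 'p) \<Rightarrow> bool" where
  "affine_coordinates S m p w \<longleftrightarrow>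
     bij_betw (affine_map m p w) (coord_space m) (affine hull S)"

definition has_partial_derivative ::
  "((nat \<Rightarrow> real) \<Rightarrow> real) \<Rightarrow> nat \<Rightarrow> real \<Rightarrow> (nat \<Rightarrow> real) \<Rightarrow> bool" where
  "has_partial_derivative G i D t \<longleftrightarrow>
     ((\<lambda>s. G (t(i := s))) has_real_derivative D) (at (t i))"

(* The matrix A of second partial derivatives of G at t; the first partial derivatives g j
   have to exist on a whole neighbourhood of t in R^m. *)

definition has_hessian ::
  "nat \<Rightarrow> ((nat \<Rightarrow> real) \<Rightarrow> real) \<Rightarrow> (nat \<Rightarrow> real) \<Rightarrow> (nat \<Rightarrow> nat \<Rightarrow> real) \<Rightarrow> bool" where
  "has_hessian m G t A \<longleftrightarrow>
     (\<exists>g. (\<exists>\<epsilon>>0. \<forall>s\<in>coord_space m. (\<forall>i<m. \<bar>s i - t i\<bar> < \<epsilon>) \<longrightarrow>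
              (\<forall>j<m. has_partial_derivative G j (g j s) s)) \<and>
          (\<forall>i<m. \<forall>j<m. has_partial_derivative (g j) i (A i j) t))"

definition pos_def_matrix :: "nat \<Rightarrow> (nat \<Rightarrow> nat \<Rightarrow> real) \<Rightarrow> bool" where
  "pos_def_matrix m A \<longleftrightarrow>
     (\<forall>i<m. \<forall>j<m. A i j = A j i) \<and>
     (\<forall>x. (\<exists>i<m. x i \<noteq> 0) \<longrightarrow> (\<Sum>i<m. \<Sum>j<m. x i * A i j * x j) > 0)"

(* The Hessian of \<Phi> at \<eta>, as a function on the relatively open set L, is positive definite,
   whichever affine coordinates of the affine hull of L it is computed in. *)

definition hessian_positive_definite ::
  "'p::real_vector set \<Rightarrow> ('p \<Rightarrow> real) \<Rightarrow> 'p \<Rightarrow> bool" where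
  "hessian_positive_definite L \<Phi> \<eta> \<longleftrightarrow>
     (\<forall>m p w t. affine_coordinates L m p w \<and> t \<in> coord_space m \<and> affine_map m p w t = \<eta> \<longrightarrow>
        (\<exists>A. has_hessian m (\<lambda>s. \<Phi> (affine_map m p w s)) t A \<and> pos_def_matrix m A))"


section \<open>Multinomial inference families\<close>

(* A family of pseudomarginals is a pair: the functions b_\<alpha> (first component) and the
   functions b_i (second component). *)

type_synonym 'v multinomial_point =
  "('v set \<Rightarrow> ('v \<Rightarrow> nat) \<Rightarrow> real) \<times> ('v \<Rightarrow> nat \<Rightarrow> real)"

definition states :: "('v \<Rightarrow> nat) \<Rightarrow> 'v set \<Rightarrow> ('v \<Rightarrow> nat) set" where
  "states N \<alpha> = (\<Pi>\<^sub>E i\<in>\<alpha>. {1..N i})"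

(* The vanishing conditions only normalise the values at indices that are not part of a
   family of pseudomarginals. *)

definition multinomial_L ::
  "'v set \<Rightarrow> 'v set set \<Rightarrow> ('v \<Rightarrow> nat) \<Rightarrow> 'v multinomial_point set" where
  "multinomial_L V F N = {(bF, bV).
     (\<forall>\<alpha>\<in>F. (\<forall>x\<in>states N \<alpha>. bF \<alpha> x > 0) \<and> (\<Sum>x\<in>states N \<alpha>. bF \<alpha> x) = 1) \<and>
     (\<forall>i\<in>V. (\<forall>x\<in>{1..N i}. bV i x > 0) \<and> (\<Sum>x = 1..N i. bV i x) = 1) \<and>
     (\<forall>\<alpha>\<in>F. \<forall>i\<in>\<alpha>. \<forall>y\<in>{1..N i}. (\<Sum>x | x \<in> states N \<alpha> \<and> x i = y. bF \<alpha> x) = bV i y) \<and>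
     (\<forall>\<alpha> x. \<not> (\<alpha> \<in> F \<and> x \<in> states N \<alpha>) \<longrightarrow> bF \<alpha> x = 0) \<and>
     (\<forall>i x. \<not> (i \<in> V \<and> x \<in> {1..N i}) \<longrightarrow> bV i x = 0)}"

definition multinomial_bethe ::
  "'v set \<Rightarrow> 'v set set \<Rightarrow> ('v \<Rightarrow> nat) \<Rightarrow> ('v set \<Rightarrow> ('v \<Rightarrow> nat) \<Rightarrow> real) \<Rightarrow>
   'v multinomial_point \<Rightarrow> real" where
  "multinomial_bethe V F N \<Psi> = (\<lambda>(bF, bV).
     - (\<Sum>\<alpha>\<in>F. \<Sum>x\<in>states N \<alpha>. bF \<alpha> x * ln (\<Psi> \<alpha> x))
     + (\<Sum>\<alpha>\<in>F. \<Sum>x\<in>states N \<alpha>. bF \<alpha> x * ln (bF \<alpha> x))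
     + (\<Sum>i\<in>V. (1 - real (hdegree F i)) * (\<Sum>x = 1..N i. bV i x * ln (bV i x))))"

definition multinomial_phi :: "nat \<Rightarrow> nat \<Rightarrow> real" where
  "multinomial_phi k x = (if x = k then 1 else 0)"

definition multinomial_dim :: "('v \<Rightarrow> nat) \<Rightarrow> 'v \<Rightarrow> nat" where
  "multinomial_dim N i = N i - 1"

definition multinomial_u ::
  "('v \<Rightarrow> nat) \<Rightarrow> 'v multinomial_point \<Rightarrow> 'v set \<Rightarrow> 'v \<Rightarrow> 'v \<Rightarrow> nat \<Rightarrow> nat \<Rightarrow> real" where
  "multinomial_u N = (\<lambda>(bF, bV).
     edge_weights (multinomial_dim N)
       (\<lambda>j k l. cov (point_measure {1..N j} (\<lambda>x. ennreal (bV j x)))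
                  (multinomial_phi k) (multinomial_phi l))
       (\<lambda>\<alpha> j i k l. cov (point_measure (states N \<alpha>) (\<lambda>x. ennreal (bF \<alpha> x)))
                  (\<lambda>x. multinomial_phi k (x j)) (\<lambda>x. multinomial_phi l (x i))))"


section \<open>Fixed-mean Gaussian inference families\<close>

(* A point is a pair: the variances \<eta>_ii (first component) and, for each edge {i, j}, the
   covariance \<eta>_ij (second component). *)

type_synonym 'v gaussian_point = "('v \<Rightarrow> real) \<times> ('v set \<Rightarrow> real)"

(* For an edge \<alpha> = {i, j} the product of the variances over \<alpha> is \<eta>_ii \<eta>_jj. *)

definition edge_det :: "'v gaussian_point \<Rightarrow> 'v set \<Rightarrow> real" where
  "edge_det = (\<lambda>(\<eta>V, \<eta>E) \<alpha>. (\<Prod>i\<in>\<alpha>. \<eta>V i) - (\<eta>E \<alpha>)\<^sup>2)"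

definition gaussian_L :: "'v set \<Rightarrow> 'v set set \<Rightarrow> 'v gaussian_point set" where
  "gaussian_L V E = {(\<eta>V, \<eta>E).
     (\<forall>i\<in>V. \<eta>V i > 0) \<and> (\<forall>\<alpha>\<in>E. edge_det (\<eta>V, \<eta>E) \<alpha> > 0) \<and>
     (\<forall>i. i \<notin> V \<longrightarrow> \<eta>V i = 0) \<and> (\<forall>\<alpha>. \<alpha> \<notin> E \<longrightarrow> \<eta>E \<alpha> = 0)}"

definition gaussian_bethe ::
  "'v set \<Rightarrow> 'v set set \<Rightarrow> ('v gaussian_point \<Rightarrow> real) \<Rightarrow> real \<Rightarrow> 'v gaussian_point \<Rightarrow> real" where
  "gaussian_bethe V E \<l> c \<eta> =
     \<l> \<eta> - (1/2) * (\<Sum>\<alpha>\<in>E. ln (edge_det \<eta> \<alpha>))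
     - (1/2) * (\<Sum>i\<in>V. (1 - real (hdegree E i)) * ln (fst \<eta> i)) + c"

definition normal_measure :: "real \<Rightarrow> real \<Rightarrow> real measure" where
  "normal_measure a v = density lborel (\<lambda>x. ennreal (normal_density a (sqrt v) x))"

(* The bivariate normal density with mean (a, b) and covariance matrix ((v, c), (c, w)). *)

definition normal2_density ::
  "real \<Rightarrow> real \<Rightarrow> real \<Rightarrow> real \<Rightarrow> real \<Rightarrow> real \<times> real \<Rightarrow> real" where
  "normal2_density a b v c w = (\<lambda>(x, y).
     1 / (2 * pi * sqrt (v * w - c\<^sup>2)) *
     exp (- (w * (x - a)\<^sup>2 - 2 * c * (x - a) * (y - b) + v * (y - b)\<^sup>2) / (2 * (v * w - c\<^sup>2))))"

definition normal2_measure ::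
  "real \<Rightarrow> real \<Rightarrow> real \<Rightarrow> real \<Rightarrow> real \<Rightarrow> (real \<times> real) measure" where
  "normal2_measure a b v c w = density lborel (\<lambda>z. ennreal (normal2_density a b v c w z))"

definition gaussian_phi :: "('v \<Rightarrow> real) \<Rightarrow> 'v \<Rightarrow> real \<Rightarrow> real" where
  "gaussian_phi \<mu> i x = (x - \<mu> i)\<^sup>2"

definition gaussian_dim :: "'v \<Rightarrow> nat" where
  "gaussian_dim i = 1"

(* Only the entry k = l = 1 is used.  For \<alpha> = {i, j}, b_\<alpha> is taken as the joint law of the
   ordered pair (x_j, x_i). *)

definition gaussian_u ::
  "('v \<Rightarrow> real) \<Rightarrow> 'v gaussian_point \<Rightarrow> 'v set \<Rightarrow> 'v \<Rightarrow> 'v \<Rightarrow> nat \<Rightarrow> nat \<Rightarrow> real" where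
  "gaussian_u \<mu> = (\<lambda>(\<eta>V, \<eta>E).
     edge_weights gaussian_dim
       (\<lambda>j k l. cov (normal_measure (\<mu> j) (\<eta>V j)) (gaussian_phi \<mu> j) (gaussian_phi \<mu> j))
       (\<lambda>\<alpha> j i k l. cov (normal2_measure (\<mu> j) (\<mu> i) (\<eta>V j) (\<eta>E \<alpha>) (\<eta>V i))
                      (\<lambda>(x, y). gaussian_phi \<mu> j x) (\<lambda>(x, y). gaussian_phi \<mu> i y)))"

end

theory Submission
  imports Defs
begin

text \<open>Minimizing the quadratic form of the Hessian over the factor beliefs, with the vertex
  means \<open>y\<close> fixed, leaves the form \<open>R(y) = \<Sum>\<^sub>\<alpha> y\<^sub>\<alpha> V\<^sub>\<alpha>\<inverse> y\<^sub>\<alpha> + \<Sum>\<^sub>i (1 - d\<^sub>i) y\<^sub>i V\<^sub>i\<inverse> y\<^sub>i\<close>, where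
  \<open>V\<^sub>\<alpha>\<close> and \<open>V\<^sub>i\<close> are the covariance matrices of the sufficient statistics.  Scale the
  off-diagonal blocks of every \<open>V\<^sub>\<alpha>\<close> by \<open>t\<close>.  At \<open>t = 0\<close> the form becomes
  \<open>\<Sum>\<^sub>i y\<^sub>i V\<^sub>i\<inverse> y\<^sub>i\<close>, which is positive definite.  If \<open>y\<close> is in the kernel at \<open>t > 0\<close>,
  then the messages \<open>f(\<alpha> \<rightarrow> i) = V\<^sub>i\<inverse> y\<^sub>i - (V\<^sub>\<alpha>(t)\<inverse> y\<^sub>\<alpha>)\<^sub>i\<close> satisfy \<open>f = t M f\<close>, and they vanish
  only if \<open>y = 0\<close>.  As \<open>M\<close> has no eigenvalue \<open>1/t \<ge> 1\<close>, the form never degenerates along the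
  path, so it is still positive definite at \<open>t = 1\<close>.\<close>

section \<open>Positive definite matrices over finite index sets\<close>

text \<open>The coefficients \<open>1 - d\<^sub>i\<close> are negative where the degree exceeds one,
  so the Hessian is not visibly a sum of squares. \<open>M\<close> need not be symmetric and may
  have large negative or nonreal eigenvalues, so the hypothesis bounds no norm and gives no
  contraction; it can only exclude a degeneration along a real path. Scaling off-diagonal blocks
  mixes \<open>V\<^sub>\<alpha>\<close> convexly with its own block diagonal, which preserves
  positive definiteness, and multiplies the weights \<open>u\<close> by \<open>t\<close>.

  The message equation arises as follows. Put
  \<open>a = V\<^sub>\<alpha>(t)\<inverse> y\<^sub>\<alpha>\<close>. Block row \<open>i\<close> of
  \<open>V\<^sub>\<alpha>(t) a = y\<^sub>\<alpha>\<close>, multiplied by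
  \<open>V\<^sub>i\<inverse>\<close>, says that the message from \<alpha> to \<open>i\<close> is
  \<open>t\<close> times the sum of \<open>u a\<^sub>j\<close> over the other \<open>j\<close> in
  \<alpha>. The kernel equation says that the messages into \<open>j\<close> sum to
  \<open>V\<^sub>j\<inverse> y\<^sub>j\<close>; leaving out the one from \<alpha> leaves
  \<open>a\<^sub>j\<close>. If all messages vanish, that same sum returns \<open>y = 0\<close>.

  The minimum over factor beliefs is never computed: for every multiplier \<open>a\<close> the
  factor Hessian is at least \<open>2 a \<cdot> y - a V\<^sub>\<alpha> a\<close>, and a single good
  \<open>a\<close> suffices.\<close>

definition quad :: "'i set \<Rightarrow> ('i \<Rightarrow> 'i \<Rightarrow> real) \<Rightarrow> ('i \<Rightarrow> real) \<Rightarrow> ('i \<Rightarrow> real) \<Rightarrow> real" where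
  "quad I A x y = (\<Sum>i\<in>I. \<Sum>j\<in>I. x i * A i j * y j)"

definition pd_on :: "'i set \<Rightarrow> ('i \<Rightarrow> 'i \<Rightarrow> real) \<Rightarrow> bool" where
  "pd_on I A \<longleftrightarrow> (\<forall>i\<in>I. \<forall>j\<in>I. A i j = A j i) \<and> (\<forall>x. (\<exists>i\<in>I. x i \<noteq> 0) \<longrightarrow> quad I A x x > 0)"

lemma pd_onI:
  assumes "\<And>i j. i \<in> I \<Longrightarrow> j \<in> I \<Longrightarrow> A i j = A j i"
    and "\<And>x i. i \<in> I \<Longrightarrow> x i \<noteq> 0 \<Longrightarrow> quad I A x x > 0"
  shows "pd_on I A"
  using assms unfolding pd_on_def by blast

lemma pd_on_sym: "pd_on I A \<Longrightarrow> i \<in> I \<Longrightarrow> j \<in> I \<Longrightarrow> A i j = A j i"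
  unfolding pd_on_def by blast

lemma pd_on_pos: "pd_on I A \<Longrightarrow> i \<in> I \<Longrightarrow> x i \<noteq> 0 \<Longrightarrow> quad I A x x > 0"
  unfolding pd_on_def by blast

lemma pd_on_nonneg:
  assumes "pd_on I A"
  shows "quad I A x x \<ge> 0"
proof (cases "\<exists>i\<in>I. x i \<noteq> 0")
  case True
  then show ?thesis using assms unfolding pd_on_def by force
next
  case False
  then show ?thesis by (simp add: quad_def)
qed

lemma quad_apply: "quad I A x y = (\<Sum>i\<in>I. x i * (\<Sum>j\<in>I. A i j * y j))"
  by (simp add: quad_def sum_distrib_left mult.assoc)

lemma quad_commute:
  assumes "\<And>i j. i \<in> I \<Longrightarrow> j \<in> I \<Longrightarrow> A i j = A j i"
  shows "quad I A x y = quad I A y x"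
  unfolding quad_def by (subst sum.swap) (auto intro!: sum.cong simp: assms)

text \<open>Expansion along a line: where a nonnegative form vanishes, the term linear in
  \<open>s\<close> has to vanish too.\<close>

lemma quad_add_scale:
  assumes "\<And>i j. i \<in> I \<Longrightarrow> j \<in> I \<Longrightarrow> A i j = A j i"
  shows "quad I A (\<lambda>i. x i + s * z i) (\<lambda>i. x i + s * z i)
           = quad I A x x + 2 * s * quad I A z x + s\<^sup>2 * quad I A z z"
proof -
  have "quad I A (\<lambda>i. x i + s * z i) (\<lambda>i. x i + s * z i)
     = quad I A x x + s * quad I A x z + s * quad I A z x + s\<^sup>2 * quad I A z z"
    unfolding quad_def sum_distrib_left sum.distrib[symmetric]
    by (intro sum.cong refl) (simp add: algebra_simps power2_eq_square)
  then show ?thesis using quad_commute[of I A x z, OF assms] by simp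
qed

lemma quad_scale: "quad I A (\<lambda>i. c * x i) (\<lambda>i. c * x i) = c\<^sup>2 * quad I A x x"
  unfolding quad_def sum_distrib_left
  by (intro sum.cong refl) (simp add: algebra_simps power2_eq_square)

lemma quad_combine:
  "quad I (\<lambda>i j. a * A i j + b * B i j) x y = a * quad I A x y + b * quad I B x y"
  unfolding quad_def sum_distrib_left sum.distrib[symmetric]
  by (intro sum.cong refl) (simp add: algebra_simps)

text \<open>Applied to a factor covariance and its block diagonal, this keeps the interpolated
  matrix invertible for every parameter in \<open>{0..1}\<close>.\<close>

lemma pd_on_convex:
  assumes A: "pd_on I A" and B: "pd_on I B" and ab: "a \<ge> 0" "b \<ge> 0" "a + b = (1::real)"
  shows "pd_on I (\<lambda>i j. a * A i j + b * B i j)"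
proof (rule pd_onI)
  show "a * A i j + b * B i j = a * A j i + b * B j i" if "i \<in> I" "j \<in> I" for i j
    using pd_on_sym[OF A that] pd_on_sym[OF B that] by simp
  show "quad I (\<lambda>i j. a * A i j + b * B i j) x x > 0" if "i \<in> I" "x i \<noteq> 0" for x i
    unfolding quad_combine
    using pd_on_pos[of I A i x, OF A that] pd_on_pos[of I B i x, OF B that] ab
    by (cases "a = 0") (auto intro: add_pos_nonneg)
qed

section \<open>Linear systems depending continuously on a parameter\<close>

text \<open>Block elimination of one index; the Schur complement of the pivot is again positive
  definite and continuous.\<close>

lemma pd_solve_continuous:
  fixes A :: "'t::topological_space \<Rightarrow> 'i \<Rightarrow> 'i \<Rightarrow> real"
  assumes "finite I"
    and "\<And>t. t \<in> T \<Longrightarrow> pd_on I (A t)"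
    and "\<And>i j. i \<in> I \<Longrightarrow> j \<in> I \<Longrightarrow> continuous_on T (\<lambda>t. A t i j)"
    and "\<And>i. i \<in> I \<Longrightarrow> continuous_on T (\<lambda>t. y t i)"
  shows "\<exists>a. (\<forall>i\<in>I. continuous_on T (\<lambda>t. a t i)) \<and>
             (\<forall>t\<in>T. \<forall>i\<in>I. (\<Sum>j\<in>I. A t i j * a t j) = y t i)"
  using assms
proof (induction I arbitrary: A y rule: finite_induct)
  case empty
  then show ?case by simp
next
  case (insert p I)
  note fin = insert.hyps(1) and pI = insert.hyps(2)
  note pd = insert.prems(1) and cA = insert.prems(2) and cy = insert.prems(3)
  have piv: "A t p p > 0" if "t \<in> T" for t
  proof -
    have "quad (insert p I) (A t) (\<lambda>i. if i = p then 1 else 0) (\<lambda>i. if i = p then 1 else 0) > 0"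
      by (rule pd_on_pos[OF pd[OF that], of p]) auto
    moreover have "(\<Sum>j\<in>I. A t p j * (if j = p then 1 else 0)) = 0"
      "(\<Sum>i\<in>I. (if i = p then 1 else 0) * (\<Sum>j\<in>insert p I. A t i j * (if j = p then 1 else 0))) = 0"
      using pI by (auto intro!: sum.neutral)
    ultimately show ?thesis using fin pI by (simp add: quad_apply)
  qed
  \<comment> \<open>\<open>z\<close> is the right-hand side after eliminating the unknown at
    \<open>p\<close>. It varies with \<open>t\<close> through \<open>A\<close> even when
    \<open>y\<close> is constant, which is why the statement lets \<open>y\<close> depend on
    \<open>t\<close>.\<close>
  define S where "S t i j = A t i j - A t i p * A t p j / A t p p" for t i j
  define z where "z t i = y t i - A t i p * y t p / A t p p" for t i
  have pdS: "pd_on I (S t)" if t: "t \<in> T" for t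
  proof (rule pd_onI)
    show "S t i j = S t j i" if "i \<in> I" "j \<in> I" for i j
      unfolding S_def using pd_on_sym[OF pd[OF t]] that by simp
  next
    fix x :: "'i \<Rightarrow> real" and i assume i: "i \<in> I" "x i \<noteq> 0"
    define s where "s = (\<Sum>j\<in>I. A t p j * x j)"
    \<comment> \<open>The entry at \<open>p\<close> minimizes the form of \<open>A t\<close> over
      that coordinate: row \<open>p\<close> applied to \<open>x'\<close> vanishes, and what is left
      is the form of \<open>S t\<close> at \<open>x\<close>.\<close>
    define x' where "x' = (\<lambda>i. if i = p then - s / A t p p else x i)"
    have x'I: "x' j = x j" if "j \<in> I" for j using that pI by (auto simp: x'_def)
    have x'p: "x' p = - s / A t p p" by (simp add: x'_def)
    have row: "(\<Sum>j\<in>insert p I. A t k j * x' j) = (\<Sum>j\<in>I. S t k j * x j)" if "k \<in> I" for k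
    proof -
      have "(\<Sum>j\<in>I. A t k j * x' j) = (\<Sum>j\<in>I. A t k j * x j)"
        by (intro sum.cong refl) (simp add: x'I)
      then show ?thesis using fin pI
        by (simp add: S_def x'p s_def left_diff_distrib sum_subtractf sum_divide_distrib sum_distrib_left mult.assoc)
    qed
    have rowp: "(\<Sum>j\<in>insert p I. A t p j * x' j) = 0"
    proof -
      have "(\<Sum>j\<in>I. A t p j * x' j) = s" unfolding s_def
        by (intro sum.cong refl) (simp add: x'I)
      then show ?thesis using fin pI piv[OF t] by (simp add: x'p)
    qed
    have "quad (insert p I) (A t) x' x' = quad I (S t) x x"
      using fin pI rowp row x'I unfolding quad_apply
      by (simp del: sum.insert add: sum.insert[OF fin pI, of "\<lambda>i. x' i * _ i"])
    moreover have "quad (insert p I) (A t) x' x' > 0"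
      using pd_on_pos[OF pd[OF t], of i x'] i x'I by auto
    ultimately show "quad I (S t) x x > 0" by simp
  qed
  have cS: "continuous_on T (\<lambda>t. S t i j)" if "i \<in> I" "j \<in> I" for i j
    unfolding S_def using that piv by (intro continuous_intros cA) force+
  have cz: "continuous_on T (\<lambda>t. z t i)" if "i \<in> I" for i
    unfolding z_def using that piv by (intro continuous_intros cA cy) force+
  from insert.IH[of S z, OF pdS cS cz] obtain a where
    ca: "\<And>i. i \<in> I \<Longrightarrow> continuous_on T (\<lambda>t. a t i)" and
    a: "\<And>t i. t \<in> T \<Longrightarrow> i \<in> I \<Longrightarrow> (\<Sum>j\<in>I. S t i j * a t j) = z t i" by blast
  define b where "b t i = (if i = p then (y t p - (\<Sum>j\<in>I. A t p j * a t j)) / A t p p else a t i)"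
    for t i
  have bI: "b t j = a t j" if "j \<in> I" for t j using that pI by (auto simp: b_def)
  have bp: "b t p = (y t p - (\<Sum>j\<in>I. A t p j * a t j)) / A t p p" for t by (simp add: b_def)
  have sumb: "(\<Sum>j\<in>insert p I. A t i j * b t j) = A t i p * b t p + (\<Sum>j\<in>I. A t i j * a t j)" for t i
    using fin pI by (simp add: bI cong: sum.cong)
  show ?case
  proof (intro exI[of _ b] conjI ballI)
    fix i assume "i \<in> insert p I"
    show "continuous_on T (\<lambda>t. b t i)"
    proof (cases "i = p")
      case True
      show ?thesis unfolding True bp using piv
        by (intro continuous_intros cA cy ca) force+
    next
      case False
      then show ?thesis using \<open>i \<in> insert p I\<close> by (simp add: b_def ca)
    qed
  next
    fix t i assume t: "t \<in> T" and i: "i \<in> insert p I"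
    show "(\<Sum>j\<in>insert p I. A t i j * b t j) = y t i"
    proof (cases "i = p")
      case True
      then show ?thesis unfolding sumb bp using piv[OF t] by simp
    next
      case False
      then have "i \<in> I" using i by simp
      from a[OF t this] have "(\<Sum>j\<in>I. A t i j * a t j) - A t i p * (\<Sum>j\<in>I. A t p j * a t j) / A t p p
          = y t i - A t i p * y t p / A t p p"
        by (simp add: S_def z_def left_diff_distrib sum_subtractf sum_divide_distrib sum_distrib_left mult.assoc)
      then show ?thesis unfolding sumb bp using piv[OF t] by (simp add: field_simps)
    qed
  qed
qed

section \<open>Continuation of positive definiteness along a path\<close>

text \<open>Functions carry the product topology and the index type is arbitrary, so compactness
  comes from Tychonoff: the coordinates outside \<open>I\<close> are pinned to the single point 0,
  those inside range over \<open>{-1..1}\<close>, and the condition on the sum of squares is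
  closed.\<close>

lemma compact_unit_sphere_on:
  assumes "finite I"
  shows "compact {x :: 'i \<Rightarrow> real. (\<forall>i. i \<notin> I \<longrightarrow> x i = 0) \<and> (\<Sum>i\<in>I. (x i)\<^sup>2) = 1}" (is "compact ?K")
proof -
  define B where "B = Pi\<^sub>E UNIV (\<lambda>i::'i. if i \<in> I then {-1..1} else {0::real})"
  have "compact B"
  proof -
    have "compactin (product_topology (\<lambda>i. euclidean) UNIV) B"
      unfolding B_def by (subst compactin_PiE) auto
    then show ?thesis by (simp add: euclidean_product_topology)
  qed
  moreover have "closed {x :: 'i \<Rightarrow> real. (\<Sum>i\<in>I. (x i)\<^sup>2) = 1}"
    by (intro closed_Collect_eq continuous_intros continuous_on_product_coordinates)
  ultimately have "compact (B \<inter> {x :: 'i \<Rightarrow> real. (\<Sum>i\<in>I. (x i)\<^sup>2) = 1})"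
    by (rule compact_Int_closed)
  moreover have "?K = B \<inter> {x :: 'i \<Rightarrow> real. (\<Sum>i\<in>I. (x i)\<^sup>2) = 1}"
  proof -
    have "- 1 \<le> x i \<and> x i \<le> 1" if "(\<Sum>i\<in>I. (x i)\<^sup>2) = 1" "i \<in> I" for x :: "'i \<Rightarrow> real" and i
    proof -
      have "(x i)\<^sup>2 \<le> (\<Sum>i\<in>I. (x i)\<^sup>2)" using assms that by (intro member_le_sum) auto
      then have "(x i)\<^sup>2 \<le> 1" using that by simp
      then show ?thesis by (simp add: abs_square_le_1 abs_le_iff minus_le_iff)
    qed
    then show ?thesis by (auto simp: B_def PiE_iff extensional_def split: if_splits)
  qed
  ultimately show ?thesis by simp
qed

text \<open>At the first parameter where positive definiteness fails, the form is still
  nonnegative, so a unit vector on which it vanishes minimizes it and lies in the kernel.\<close>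

lemma pd_on_path:
  fixes A :: "real \<Rightarrow> 'i \<Rightarrow> 'i \<Rightarrow> real"
  assumes fin: "finite I"
    and sym: "\<And>t i j. t \<in> {0..1} \<Longrightarrow> i \<in> I \<Longrightarrow> j \<in> I \<Longrightarrow> A t i j = A t j i"
    and cont: "\<And>i j. i \<in> I \<Longrightarrow> j \<in> I \<Longrightarrow> continuous_on {0..1} (\<lambda>t. A t i j)"
    and start: "pd_on I (A 0)"
    and nondeg: "\<And>t x i. t \<in> {0<..1} \<Longrightarrow> (\<And>i. i \<in> I \<Longrightarrow> (\<Sum>j\<in>I. A t i j * x j) = 0) \<Longrightarrow> i \<in> I \<Longrightarrow> x i = 0"
  shows "pd_on I (A 1)"
proof -
  define K where "K = {x :: 'i \<Rightarrow> real. (\<forall>i. i \<notin> I \<longrightarrow> x i = 0) \<and> (\<Sum>i\<in>I. (x i)\<^sup>2) = 1}"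
  have cK: "compact K" unfolding K_def by (rule compact_unit_sphere_on[OF fin])
  have clK: "closed K"
  proof -
    have "closed {x :: 'i \<Rightarrow> real. (\<Sum>i\<in>I. (x i)\<^sup>2) = 1}"
      by (intro closed_Collect_eq continuous_intros continuous_on_product_coordinates)
    moreover have "closed {x :: 'i \<Rightarrow> real. \<forall>i. i \<notin> I \<longrightarrow> x i = 0}"
      by (intro closed_Collect_all closed_Collect_imp closed_Collect_eq continuous_intros
          continuous_on_product_coordinates) auto
    ultimately have "closed ({x :: 'i \<Rightarrow> real. \<forall>i. i \<notin> I \<longrightarrow> x i = 0} \<inter> {x. (\<Sum>i\<in>I. (x i)\<^sup>2) = 1})"
      by (intro closed_Int)
    then show ?thesis by (simp add: K_def Collect_conj_eq)
  qed
  \<comment> \<open>The factor \<open>c\<close> does not depend on \<open>t\<close>, so signs along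
    the whole path can be tested on the compact set \<open>K\<close>.\<close>
  have scale: "\<exists>y\<in>K. \<exists>c>0. \<forall>t. quad I (A t) x x = c * quad I (A t) y y"
    if "i \<in> I" "x i \<noteq> 0" for x i
  proof -
    define n where "n = sqrt (\<Sum>i\<in>I. (x i)\<^sup>2)"
    have "(x i)\<^sup>2 \<le> (\<Sum>i\<in>I. (x i)\<^sup>2)" using fin that by (intro member_le_sum) auto
    then have n: "n > 0" "n\<^sup>2 = (\<Sum>i\<in>I. (x i)\<^sup>2)" using that
      by (auto simp: n_def) (smt (verit) zero_less_power2)+
    define y where "y = (\<lambda>i. if i \<in> I then x i / n else 0)"
    have "(\<Sum>i\<in>I. (y i)\<^sup>2) = (\<Sum>i\<in>I. (x i)\<^sup>2) / n\<^sup>2"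
      by (simp add: y_def power_divide sum_divide_distrib)
    then have "y \<in> K" using n by (auto simp: K_def y_def)
    moreover have "quad I (A t) x x = n\<^sup>2 * quad I (A t) y y" for t
    proof -
      have "quad I (A t) x x = quad I (A t) (\<lambda>i. n * y i) (\<lambda>i. n * y i)"
        unfolding quad_def using n by (intro sum.cong refl) (simp add: y_def)
      then show ?thesis by (simp add: quad_scale)
    qed
    ultimately show ?thesis using n by (metis zero_less_power)
  qed
  have K_nz: "\<exists>i\<in>I. x i \<noteq> 0" if "x \<in> K" for x
    using that unfolding K_def by (force intro: ccontr)
  have cq: "continuous_on {0..1} (\<lambda>t. quad I (A t) x x)" for x
    unfolding quad_def by (intro continuous_intros cont)
  have cq2: "continuous_on ({0..1} \<times> K) (\<lambda>z. quad I (A (fst z)) (snd z) (snd z))"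
  proof -
    have c1: "continuous_on ({0..1} \<times> K) (\<lambda>z. A (fst z) i j)" if "i \<in> I" "j \<in> I" for i j
      by (rule continuous_on_compose2[OF cont[OF that] continuous_on_fst[OF continuous_on_id]]) auto
    have c2: "continuous_on ({0..1} \<times> K) (\<lambda>z. snd z i)" for i
      by (rule continuous_on_compose2[of UNIV "\<lambda>x. x i" _ snd])
         (auto intro: continuous_on_snd continuous_on_id)
    show ?thesis unfolding quad_def by (intro continuous_intros c1 c2)
  qed
  \<comment> \<open>Parameter and vector are kept together: by joint continuity \<open>Bad\<close>
    is compact, hence so is its projection to the parameters, which therefore has a least
    element.\<close>
  define Bad where "Bad = {z \<in> {0..1} \<times> K. quad I (A (fst z)) (snd z) (snd z) \<le> 0}"
  have "compact Bad"
  proof -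
    have "closed Bad" unfolding Bad_def
      by (rule continuous_on_closed_Collect_le[OF cq2 continuous_on_const closed_Times[OF _ clK]]) simp
    then have "compact (({0..1} \<times> K) \<inter> Bad)"
      by (intro compact_Int_closed compact_Times cK) auto
    moreover have "({0..1} \<times> K) \<inter> Bad = Bad" by (auto simp: Bad_def)
    ultimately show ?thesis by simp
  qed
  then have cB: "compact (fst ` Bad)"
    by (intro compact_continuous_image continuous_on_fst continuous_on_id)
  have "Bad = {}"
  proof (rule ccontr)
    assume "Bad \<noteq> {}"
    then obtain t0 where t0: "t0 \<in> fst ` Bad" and least: "\<And>t. t \<in> fst ` Bad \<Longrightarrow> t0 \<le> t"
      using compact_attains_inf[OF cB] by blast
    then obtain x0 where x0: "x0 \<in> K" "quad I (A t0) x0 x0 \<le> 0" and t01: "t0 \<in> {0..1}"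
      by (auto simp: Bad_def)
    have "t0 \<noteq> 0"
      using x0 K_nz[OF x0(1)] pd_on_pos[OF start] by force
    then have t0: "t0 \<in> {0<..1}" using t01 by auto
    have before: "quad I (A t) x x > 0" if "x \<in> K" "t \<in> {0..<t0}" for t x
      using least[of t] that t0 by (force simp: Bad_def image_iff)
    \<comment> \<open>Positivity before \<open>t0\<close> survives as nonnegativity in the limit
      from the left; \<open>t0 > 0\<close> makes \<open>t0\<close> a limit point of
      \<open>{0..<t0}\<close>.\<close>
    have nnK: "quad I (A t0) x x \<ge> 0" if x: "x \<in> K" for x
    proof -
      have "((\<lambda>t. quad I (A t) x x) \<longlongrightarrow> quad I (A t0) x x) (at t0 within {0..1})"
        using cq t01 by (simp add: continuous_on_def)
      then have "((\<lambda>t. quad I (A t) x x) \<longlongrightarrow> quad I (A t0) x x) (at t0 within {0..<t0})"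
        by (rule tendsto_within_subset) (use t0 in auto)
      moreover have "at t0 within {0..<t0} \<noteq> bot"
        using t0 by (auto simp: trivial_limit_within islimpt_Ico)
      moreover have "\<forall>\<^sub>F t in at t0 within {0..<t0}. quad I (A t) x x \<ge> 0"
        unfolding eventually_at_filter using before[OF x] by (auto intro!: always_eventually less_imp_le)
      ultimately show ?thesis using tendsto_lowerbound by blast
    qed
    have nn: "quad I (A t0) x x \<ge> 0" for x
    proof (cases "\<exists>i\<in>I. x i \<noteq> 0")
      case True
      then obtain i where "i \<in> I" "x i \<noteq> 0" by blast
      from scale[of i x, OF this] nnK show ?thesis by force
    next
      case False
      then show ?thesis by (simp add: quad_def)
    qed
    have q0: "quad I (A t0) x0 x0 = 0" using x0 nn[of x0] by simp
    have ker: "quad I (A t0) z x0 = 0" for z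
    proof (rule ccontr)
      assume b: "quad I (A t0) z x0 \<noteq> 0"
      define c where "c = quad I (A t0) z z"
      have c: "c \<ge> 0" using nn c_def by simp
      have ineq: "2 * s * quad I (A t0) z x0 + s\<^sup>2 * c \<ge> 0" for s
        using nn[of "\<lambda>i. x0 i + s * z i"] quad_add_scale[of I "A t0" x0 s z] sym[OF t01] q0
        by (simp add: c_def)
      define b where "b = quad I (A t0) z x0"
      \<comment> \<open>A nearly optimal step along \<open>z\<close>; \<open>c + 1\<close> in place
        of \<open>c\<close> avoids dividing by zero. The expansion then has the value
        \<open>- b\<^sup>2 (c + 2) / (c + 1)\<^sup>2\<close>, which is negative for
        \<open>b \<noteq> 0\<close>.\<close>
      define s where "s = - b / (c + 1)"
      have s: "s * (c + 1) = - b" using c by (simp add: s_def)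
      have "(c + 1)\<^sup>2 * (2 * s * b + s\<^sup>2 * c) = 2 * (s * (c + 1)) * b * (c + 1) + (s * (c + 1))\<^sup>2 * c"
        by algebra
      also have "\<dots> = - 2 * b\<^sup>2 * (c + 1) + b\<^sup>2 * c"
        unfolding s by algebra
      finally have "- 2 * b\<^sup>2 * (c + 1) + b\<^sup>2 * c \<ge> 0"
        using ineq[of s] c by (metis b_def mult_nonneg_nonneg zero_le_power2)
      then have "b\<^sup>2 * (c + 2) \<le> 0" by (simp add: algebra_simps)
      moreover have "b\<^sup>2 * (c + 2) > 0" using c b b_def by simp
      ultimately show False by simp
    qed
    have "(\<Sum>j\<in>I. A t0 i j * x0 j) = 0" if "i \<in> I" for i
    proof -
      have "quad I (A t0) (\<lambda>k. if k = i then 1 else 0) x0 = (\<Sum>j\<in>I. A t0 i j * x0 j)"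
        unfolding quad_apply using fin that by (simp add: if_distrib[of "\<lambda>c. c * _"] sum.delta cong: if_cong)
      then show ?thesis using ker by simp
    qed
    then have "x0 i = 0" if "i \<in> I" for i using nondeg[OF t0] that by blast
    then show False using K_nz[OF x0(1)] by blast
  qed
  have pos: "quad I (A 1) x x > 0" if "x \<in> K" for x
  proof (rule ccontr)
    assume "\<not> quad I (A 1) x x > 0"
    then have "(1, x) \<in> Bad" using that by (simp add: Bad_def)
    then show False using \<open>Bad = {}\<close> by simp
  qed
  show ?thesis
  proof (rule pd_onI)
    show "A 1 i j = A 1 j i" if "i \<in> I" "j \<in> I" for i j using sym that by simp
    show "quad I (A 1) x x > 0" if "i \<in> I" "x i \<noteq> 0" for x i
      using scale[of i x, OF that] pos by force
  qed
qed

section \<open>Inverses of positive definite matrices\<close>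

text \<open>Since \<open>A W = 1\<close>, the form of \<open>A\<close> on two columns of
  \<open>W\<close> collapses to one entry of \<open>W\<close>; exchanging the columns transposes
  that entry, and the symmetry of \<open>A\<close> makes the two values equal.\<close>

lemma pd_on_right_inverse_sym:
  assumes fin: "finite I" and A: "pd_on I A"
    and W: "\<And>i k. i \<in> I \<Longrightarrow> k \<in> I \<Longrightarrow> (\<Sum>j\<in>I. A i j * W j k) = (if i = k then 1 else 0)"
    and ik: "i \<in> I" "k \<in> I"
  shows "W i k = W k i"
proof -
  have "quad I A (\<lambda>m. W m i') (\<lambda>m. W m k') = W k' i'" if "i' \<in> I" "k' \<in> I" for i' k'
    unfolding quad_apply using fin that by (simp add: W if_distrib cong: if_cong)
  then show ?thesis
    using quad_commute[of I A "\<lambda>m. W m i" "\<lambda>m. W m k"] pd_on_sym[OF A] ik by simp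
qed

text \<open>Column \<open>k\<close> of the inverse solves the system with the \<open>k\<close>-th
  unit vector on the right, so \<open>pd_solve_continuous\<close> provides it continuously in
  \<open>t\<close>.\<close>

lemma pd_inverse_continuous:
  fixes A :: "'t::topological_space \<Rightarrow> 'i \<Rightarrow> 'i \<Rightarrow> real"
  assumes fin: "finite I"
    and pd: "\<And>t. t \<in> T \<Longrightarrow> pd_on I (A t)"
    and cont: "\<And>i j. i \<in> I \<Longrightarrow> j \<in> I \<Longrightarrow> continuous_on T (\<lambda>t. A t i j)"
  shows "\<exists>W. (\<forall>i\<in>I. \<forall>j\<in>I. continuous_on T (\<lambda>t. W t i j)) \<and>
             (\<forall>t\<in>T. \<forall>i\<in>I. \<forall>j\<in>I. W t i j = W t j i) \<and>
             (\<forall>t\<in>T. \<forall>i\<in>I. \<forall>k\<in>I. (\<Sum>j\<in>I. A t i j * W t j k) = (if i = k then 1 else 0))"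
proof -
  have "\<exists>a. (\<forall>i\<in>I. continuous_on T (\<lambda>t. a t i)) \<and>
             (\<forall>t\<in>T. \<forall>i\<in>I. (\<Sum>j\<in>I. A t i j * a t j) = (if i = k then 1 else 0))" for k
    by (rule pd_solve_continuous[OF fin pd cont]) auto
  then obtain a where
    ca: "\<And>k i. i \<in> I \<Longrightarrow> continuous_on T (\<lambda>t. a k t i)" and
    a: "\<And>k t i. t \<in> T \<Longrightarrow> i \<in> I \<Longrightarrow> (\<Sum>j\<in>I. A t i j * a k t j) = (if i = k then 1 else 0)"
    by metis
  have "a k t i = a i t k" if "t \<in> T" "i \<in> I" "k \<in> I" for t i k
    by (rule pd_on_right_inverse_sym[OF fin pd[OF that(1)], of "\<lambda>i k. a k t i"]) (use a that in auto)
  then show ?thesis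
    by (intro exI[of _ "\<lambda>t i k. a k t i"]) (use ca a in auto)
qed

text \<open>\<open>matrix_inverse\<close> is a choice, meaningful once some inverse exists.
  Existence is the continuous version for a constant family over the one-point parameter set
  \<open>{0}\<close>; symmetry turns the right inverse into a left one.\<close>

lemma matrix_inverse_pd:
  assumes A: "pd_on {1..n} A"
  shows "is_matrix_inverse n A (matrix_inverse n A)"
proof -
  have "\<exists>W. (\<forall>i\<in>{1..n}. \<forall>j\<in>{1..n}. continuous_on {0::real} (\<lambda>t. W t i j)) \<and>
             (\<forall>t\<in>{0}. \<forall>i\<in>{1..n}. \<forall>j\<in>{1..n}. W t i j = W t j i) \<and>
             (\<forall>t\<in>{0}. \<forall>i\<in>{1..n}. \<forall>k\<in>{1..n}. (\<Sum>j\<in>{1..n}. A i j * W t j k) = (if i = k then 1 else 0))"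
    by (rule pd_inverse_continuous) (use A in auto)
  then obtain W' where W': "\<forall>t\<in>{0::real}. \<forall>i\<in>{1..n}. \<forall>j\<in>{1..n}. W' t i j = W' t j i"
    "\<forall>t\<in>{0}. \<forall>i\<in>{1..n}. \<forall>k\<in>{1..n}. (\<Sum>j\<in>{1..n}. A i j * W' t j k) = (if i = k then 1 else 0)"
    by (elim exE conjE) (rule that)
  define W where "W = W' 0"
  have W: "\<And>i k. i \<in> {1..n} \<Longrightarrow> k \<in> {1..n} \<Longrightarrow> (\<Sum>j=1..n. A i j * W j k) = (if i = k then 1 else 0)"
    and sym: "\<And>i k. i \<in> {1..n} \<Longrightarrow> k \<in> {1..n} \<Longrightarrow> W i k = W k i"
    using W' by (simp_all add: W_def)
  have "(\<Sum>m=1..n. W k m * A m l) = (if k = l then 1 else 0)" if "k \<in> {1..n}" "l \<in> {1..n}" for k l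
  proof -
    have "(\<Sum>m=1..n. W k m * A m l) = (\<Sum>m=1..n. A l m * W m k)"
      using sym pd_on_sym[OF A] that by (intro sum.cong refl) (simp add: mult.commute)
    then show ?thesis using W that by simp
  qed
  then have "is_matrix_inverse n A W" unfolding is_matrix_inverse_def using W by blast
  then show ?thesis unfolding matrix_inverse_def by (rule someI[of "is_matrix_inverse n A"])
qed

section \<open>The reduced Bethe form\<close>

lemma sum_indexed:
  fixes r :: "'v \<Rightarrow> nat"
  assumes "finite S"
  shows "sum f (SIGMA i:S. {1..r i}) = (\<Sum>i\<in>S. \<Sum>k=1..r i. f (i, k))"
  using assms by (simp add: sum.Sigma)

lemma sum_block_row:
  fixes x :: "'v \<times> nat \<Rightarrow> real" and r :: "'v \<Rightarrow> nat"
  assumes "finite S" "i \<in> S"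
  shows "(\<Sum>q\<in>(SIGMA i:S. {1..r i}). (if fst q = i then B (snd q) else 0) * x q)
           = (\<Sum>l=1..r i. B l * x (i, l))"
proof -
  have "(\<Sum>q\<in>(SIGMA i:S. {1..r i}). (if fst q = i then B (snd q) else 0) * x q)
      = (\<Sum>j\<in>S. if j = i then (\<Sum>l=1..r i. B l * x (i, l)) else 0)"
    unfolding sum_indexed[OF assms(1)] by (intro sum.cong refl) auto
  then show ?thesis using assms by simp
qed

text \<open>The form splits into the forms of the blocks. This is the end of the interpolation at
  which the vertices of a factor are uncorrelated.\<close>

lemma pd_on_block_diagonal:
  fixes r :: "'v \<Rightarrow> nat"
  assumes fin: "finite S" and pd: "\<And>i. i \<in> S \<Longrightarrow> pd_on {1..r i} (B i)"
  shows "pd_on (SIGMA i:S. {1..r i}) (\<lambda>p q. if fst q = fst p then B (fst p) (snd p) (snd q) else 0)"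
    (is "pd_on ?J ?D")
proof (rule pd_onI)
  show "?D p q = ?D q p" if "p \<in> ?J" "q \<in> ?J" for p q
    using that pd_on_sym[OF pd] by auto
next
  fix x :: "'v \<times> nat \<Rightarrow> real" and p assume p: "p \<in> ?J" "x p \<noteq> 0"
  have "quad ?J ?D x x = (\<Sum>i\<in>S. quad {1..r i} (B i) (\<lambda>k. x (i, k)) (\<lambda>k. x (i, k)))"
  proof -
    have "(\<Sum>q\<in>?J. ?D (i, k) q * x q) = (\<Sum>l=1..r i. B i k l * x (i, l))" if "i \<in> S" for i k
      unfolding fst_conv snd_conv by (rule sum_block_row[OF fin that])
    then show ?thesis
      unfolding quad_apply sum_indexed[OF fin, of "\<lambda>p. x p * _ p"] by (intro sum.cong refl) simp
  qed
  also have "\<dots> > 0"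
  proof (rule sum_pos2[OF fin])
    show "fst p \<in> S" using p by auto
    show "quad {1..r (fst p)} (B (fst p)) (\<lambda>k. x (fst p, k)) (\<lambda>k. x (fst p, k)) > 0"
      using p by (intro pd_on_pos[OF pd, where i = "snd p"]) auto
  qed (use pd_on_nonneg[OF pd] in auto)
  finally show "quad ?J ?D x x > 0" .
qed

text \<open>Sorting the feeding edges by target makes the inner sum run over the factors at one
  vertex \<open>j\<close>, which is where the kernel equation of the reduced form can be
  inserted.\<close>

lemma sum_dedges_feeding:
  assumes "finite F" "\<alpha> \<in> F" "i \<in> \<alpha>" "finite \<alpha>"
  shows "(\<Sum>e' | e' \<in> dedges F \<and> e' \<rightharpoonup> (\<alpha>, i). h e')
           = (\<Sum>j\<in>\<alpha> - {i}. \<Sum>\<beta>\<in>{\<beta>\<in>F. j \<in> \<beta>} - {\<alpha>}. h (\<beta>, j))"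
proof -
  have "(\<Sum>j\<in>\<alpha> - {i}. \<Sum>\<beta>\<in>{\<beta>\<in>F. j \<in> \<beta>} - {\<alpha>}. h (\<beta>, j))
      = (\<Sum>(j, \<beta>)\<in>(SIGMA j:\<alpha> - {i}. {\<beta>\<in>F. j \<in> \<beta>} - {\<alpha>}). h (\<beta>, j))"
    using assms by (intro sum.Sigma) auto
  also have "\<dots> = (\<Sum>e' | e' \<in> dedges F \<and> e' \<rightharpoonup> (\<alpha>, i). h e')"
    by (rule sum.reindex_bij_witness[of _ "\<lambda>(\<beta>, j). (j, \<beta>)" "\<lambda>(j, \<beta>). (\<beta>, j)"])
      (auto simp: dedges_def feeds_def)
  finally show ?thesis by simp
qed

text \<open>The form \<open>R\<close> at \<open>y\<close>, with \<open>g\<^sub>i = V\<^sub>i\<inverse> y\<^sub>i\<close>.  The factor contribution is stated through its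
  Legendre dual \<open>2 a \<cdot> y - a V\<^sub>\<alpha> a\<close>, so that no inverse of \<open>V\<^sub>\<alpha>\<close> (here \<open>K \<alpha>\<close>) appears.\<close>

lemma reduced_bethe_form_pos:
  fixes V :: "'v set"
  assumes finV: "finite V" and FV: "F \<subseteq> Pow V"
    and Var: "\<And>i. i \<in> V \<Longrightarrow> pd_on {1..r i} (Var i)"
    and pdK: "\<And>\<alpha>. \<alpha> \<in> F \<Longrightarrow> pd_on (SIGMA i:\<alpha>. {1..r i}) (K \<alpha>)"
    and Kdiag: "\<And>\<alpha> i k l. \<alpha> \<in> F \<Longrightarrow> i \<in> \<alpha> \<Longrightarrow> k \<in> {1..r i} \<Longrightarrow> l \<in> {1..r i} \<Longrightarrow> K \<alpha> (i, k) (i, l) = Var i k l"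
    and Koff: "\<And>\<alpha> i j k l. \<alpha> \<in> F \<Longrightarrow> i \<in> \<alpha> \<Longrightarrow> j \<in> \<alpha> \<Longrightarrow> i \<noteq> j \<Longrightarrow> k \<in> {1..r i} \<Longrightarrow> l \<in> {1..r j} \<Longrightarrow>
                 K \<alpha> (i, k) (j, l) = C \<alpha> i j k l"
    and eig: "\<And>z. edge_op_eigenvalue F r (edge_weights r Var C) z \<Longrightarrow> z \<notin> complex_of_real ` {1..}"
    and gy: "\<And>i k. i \<in> V \<Longrightarrow> k \<in> {1..r i} \<Longrightarrow> (\<Sum>l=1..r i. Var i k l * g i l) = y i k"
    and nz: "i0 \<in> V" "k0 \<in> {1..r i0}" "y i0 k0 \<noteq> 0"
  shows "\<exists>a. (\<Sum>\<alpha>\<in>F. 2 * (\<Sum>i\<in>\<alpha>. \<Sum>k=1..r i. a \<alpha> (i, k) * y i k)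
                  - quad (SIGMA i:\<alpha>. {1..r i}) (K \<alpha>) (a \<alpha>) (a \<alpha>))
            + (\<Sum>i\<in>V. (1 - real (hdegree F i)) * (\<Sum>k=1..r i. g i k * y i k)) > 0"
proof -
  define J where "J = (\<lambda>S::'v set. SIGMA i:S. {1..r i})"
  have finF: "finite F" using finV FV by (rule rev_finite_subset[OF finite_Pow_iff[THEN iffD2]])
  have fin\<alpha>: "finite \<alpha>" if "\<alpha> \<in> F" for \<alpha> using that FV finV by (auto intro: finite_subset)
  have \<alpha>V: "\<alpha> \<subseteq> V" if "\<alpha> \<in> F" for \<alpha> using that FV by auto
  have finJ: "finite (J S)" if "finite S" for S using that by (simp add: J_def)
  have sumJ: "sum f (J S) = (\<Sum>i\<in>S. \<Sum>k=1..r i. f (i, k))" if "finite S" for S and f :: "'v \<times> nat \<Rightarrow> real"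
    unfolding J_def by (rule sum_indexed[OF that])
  define d where "d = (\<lambda>i. real (hdegree F i))"
  define Wi where "Wi = (\<lambda>i. matrix_inverse (r i) (Var i))"
  have inv: "(\<Sum>m=1..r i. Var i k m * Wi i m l) = (if k = l then 1 else 0)"
    "(\<Sum>m=1..r i. Wi i k m * Var i m l) = (if k = l then 1 else 0)"
    if "i \<in> V" "k \<in> {1..r i}" "l \<in> {1..r i}" for i k l
    using matrix_inverse_pd[OF Var[OF that(1)]] that unfolding is_matrix_inverse_def Wi_def by blast+
  have Wi_cancel: "(\<Sum>m=1..r i. Wi i k m * (\<Sum>l=1..r i. Var i m l * z l)) = z k"
    if "i \<in> V" "k \<in> {1..r i}" for i k z
  proof -
    have "(\<Sum>m=1..r i. Wi i k m * (\<Sum>l=1..r i. Var i m l * z l))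
        = (\<Sum>l=1..r i. (\<Sum>m=1..r i. Wi i k m * Var i m l) * z l)"
      by (simp add: sum_distrib_left sum_distrib_right mult.assoc) (rule sum.swap)
    also have "\<dots> = (\<Sum>l=1..r i. (if k = l then 1 else 0) * z l)"
      by (intro sum.cong refl) (use that inv in auto)
    finally show ?thesis using that by (simp add: if_distrib[of "\<lambda>c. c * _"] cong: if_cong)
  qed
  have Var_cancel: "(\<Sum>m=1..r i. Var i k m * (\<Sum>l=1..r i. Wi i m l * z l)) = z k"
    if "i \<in> V" "k \<in> {1..r i}" for i k z
  proof -
    have "(\<Sum>m=1..r i. Var i k m * (\<Sum>l=1..r i. Wi i m l * z l))
        = (\<Sum>l=1..r i. (\<Sum>m=1..r i. Var i k m * Wi i m l) * z l)"
      by (simp add: sum_distrib_left sum_distrib_right mult.assoc) (rule sum.swap)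
    also have "\<dots> = (\<Sum>l=1..r i. (if k = l then 1 else 0) * z l)"
      by (intro sum.cong refl) (use that inv in auto)
    finally show ?thesis using that by (simp add: if_distrib[of "\<lambda>c. c * _"] cong: if_cong)
  qed
  have Wi_sym: "Wi i k l = Wi i l k" if "i \<in> V" "k \<in> {1..r i}" "l \<in> {1..r i}" for i k l
    by (rule pd_on_right_inverse_sym[OF _ Var[OF that(1)]]) (use inv that in auto)
  define D where "D = (\<lambda>p q. if fst q = fst p then Var (fst p) (snd p) (snd q) else 0)"
  \<comment> \<open>By \<open>Kdiag\<close> the diagonal blocks of \<open>K \<alpha>\<close> agree
    with \<open>D\<close>, so this convex combination leaves them alone and multiplies the
    off-diagonal blocks by \<open>t\<close>.\<close>
  define Kt where "Kt = (\<lambda>\<alpha> t p q. (1 - t) * D p q + t * K \<alpha> p q)"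
  have pdKt: "pd_on (J \<alpha>) (Kt \<alpha> t)" if "\<alpha> \<in> F" "t \<in> {0..1}" for \<alpha> t
    unfolding Kt_def
  proof (rule pd_on_convex)
    show "pd_on (J \<alpha>) D" unfolding J_def D_def
      using fin\<alpha>[OF that(1)] Var \<alpha>V[OF that(1)] by (intro pd_on_block_diagonal) auto
    show "pd_on (J \<alpha>) (K \<alpha>)" using pdK[OF that(1)] by (simp add: J_def)
  qed (use that in auto)
  have "\<forall>\<alpha>\<in>F. \<exists>W. (\<forall>p\<in>J \<alpha>. \<forall>q\<in>J \<alpha>. continuous_on {0..1} (\<lambda>t. W t p q)) \<and>
             (\<forall>t\<in>{0..1}. \<forall>p\<in>J \<alpha>. \<forall>q\<in>J \<alpha>. W t p q = W t q p) \<and>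
             (\<forall>t\<in>{0..1}. \<forall>p\<in>J \<alpha>. \<forall>q\<in>J \<alpha>. (\<Sum>p'\<in>J \<alpha>. Kt \<alpha> t p p' * W t p' q) = (if p = q then 1 else 0))"
  proof
    fix \<alpha> assume \<alpha>: "\<alpha> \<in> F"
    show "\<exists>W. (\<forall>p\<in>J \<alpha>. \<forall>q\<in>J \<alpha>. continuous_on {0..1} (\<lambda>t. W t p q)) \<and>
             (\<forall>t\<in>{0..1}. \<forall>p\<in>J \<alpha>. \<forall>q\<in>J \<alpha>. W t p q = W t q p) \<and>
             (\<forall>t\<in>{0..1}. \<forall>p\<in>J \<alpha>. \<forall>q\<in>J \<alpha>. (\<Sum>p'\<in>J \<alpha>. Kt \<alpha> t p p' * W t p' q) = (if p = q then 1 else 0))"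
      using finJ[OF fin\<alpha>[OF \<alpha>]] pdKt[OF \<alpha>]
      by (intro pd_inverse_continuous) (auto simp: Kt_def intro!: continuous_intros)
  qed
  from bchoice[OF this] obtain W where
    cW: "\<And>\<alpha> p q. \<alpha> \<in> F \<Longrightarrow> p \<in> J \<alpha> \<Longrightarrow> q \<in> J \<alpha> \<Longrightarrow> continuous_on {0..1} (\<lambda>t. W \<alpha> t p q)" and
    symW: "\<And>\<alpha> t p q. \<alpha> \<in> F \<Longrightarrow> t \<in> {0..1} \<Longrightarrow> p \<in> J \<alpha> \<Longrightarrow> q \<in> J \<alpha> \<Longrightarrow> W \<alpha> t p q = W \<alpha> t q p" and
    invW: "\<And>\<alpha> t p q. \<alpha> \<in> F \<Longrightarrow> t \<in> {0..1} \<Longrightarrow> p \<in> J \<alpha> \<Longrightarrow> q \<in> J \<alpha> \<Longrightarrow>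
             (\<Sum>p'\<in>J \<alpha>. Kt \<alpha> t p p' * W \<alpha> t p' q) = (if p = q then 1 else 0)"
    by blast
  define aa where "aa = (\<lambda>\<alpha> t x p. \<Sum>q\<in>J \<alpha>. W \<alpha> t p q * x q)"
  have aa: "(\<Sum>q\<in>J \<alpha>. Kt \<alpha> t p q * aa \<alpha> t x q) = x p"
    if "\<alpha> \<in> F" "t \<in> {0..1}" "p \<in> J \<alpha>" for \<alpha> t x p
  proof -
    have "(\<Sum>q\<in>J \<alpha>. Kt \<alpha> t p q * aa \<alpha> t x q)
        = (\<Sum>q\<in>J \<alpha>. (\<Sum>p'\<in>J \<alpha>. Kt \<alpha> t p p' * W \<alpha> t p' q) * x q)"
      by (simp add: aa_def sum_distrib_left sum_distrib_right mult.assoc) (rule sum.swap)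
    also have "\<dots> = (\<Sum>q\<in>J \<alpha>. (if p = q then 1 else 0) * x q)"
      by (intro sum.cong refl) (use that invW in auto)
    finally show ?thesis using that finJ[OF fin\<alpha>[OF that(1)]]
      by (simp add: if_distrib[of "\<lambda>c. c * _"] cong: if_cong)
  qed
  define G where "G = (\<lambda>x i k. \<Sum>l=1..r i. Wi i k l * x (i, l))"
  have VarG: "(\<Sum>l=1..r i. Var i k l * G x i l) = x (i, k)" if "i \<in> V" "k \<in> {1..r i}" for i k x
    unfolding G_def using Var_cancel[OF that] .
  \<comment> \<open>Block row \<open>i\<close> of the equation \<open>aa\<close>, multiplied by the
    inverse of \<open>Var i\<close>. That inverse times a block \<open>C \<alpha> i j\<close> is by
    definition the weight for the subscript \<open>j \<rightarrow> i\<close>.\<close>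
  have eqn: "aa \<alpha> t x (i, k) + t * (\<Sum>j\<in>\<alpha> - {i}. \<Sum>l=1..r j. edge_weights r Var C \<alpha> j i k l * aa \<alpha> t x (j, l))
      = G x i k" if \<alpha>: "\<alpha> \<in> F" and t: "t \<in> {0..1}" and i: "i \<in> \<alpha>" and k: "k \<in> {1..r i}" for \<alpha> t x i k
  proof -
    have iV: "i \<in> V" using \<alpha>V[OF \<alpha>] i by auto
    have row: "(\<Sum>l=1..r i. Var i m l * aa \<alpha> t x (i, l))
          + t * (\<Sum>j\<in>\<alpha> - {i}. \<Sum>l=1..r j. C \<alpha> i j m l * aa \<alpha> t x (j, l)) = x (i, m)"
      if m: "m \<in> {1..r i}" for m
    proof -
      have "x (i, m) = (\<Sum>j\<in>\<alpha>. \<Sum>l=1..r j. Kt \<alpha> t (i, m) (j, l) * aa \<alpha> t x (j, l))"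
        using aa[OF \<alpha> t, of "(i, m)" x] i m by (simp add: sumJ[OF fin\<alpha>[OF \<alpha>]]) (simp add: J_def)
      also have "\<dots> = (\<Sum>l=1..r i. Kt \<alpha> t (i, m) (i, l) * aa \<alpha> t x (i, l))
          + (\<Sum>j\<in>\<alpha> - {i}. \<Sum>l=1..r j. Kt \<alpha> t (i, m) (j, l) * aa \<alpha> t x (j, l))"
        using fin\<alpha>[OF \<alpha>] i by (rule sum.remove)
      also have "(\<Sum>l=1..r i. Kt \<alpha> t (i, m) (i, l) * aa \<alpha> t x (i, l))
          = (\<Sum>l=1..r i. Var i m l * aa \<alpha> t x (i, l))"
        using m by (intro sum.cong refl) (auto simp: Kt_def D_def Kdiag[OF \<alpha> i] algebra_simps)
      also have "(\<Sum>j\<in>\<alpha> - {i}. \<Sum>l=1..r j. Kt \<alpha> t (i, m) (j, l) * aa \<alpha> t x (j, l))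
          = t * (\<Sum>j\<in>\<alpha> - {i}. \<Sum>l=1..r j. C \<alpha> i j m l * aa \<alpha> t x (j, l))"
        unfolding sum_distrib_left using m
        by (intro sum.cong refl) (auto simp: Kt_def D_def Koff[OF \<alpha> i])
      finally show ?thesis by simp
    qed
    have "G x i k = (\<Sum>m=1..r i. Wi i k m * ((\<Sum>l=1..r i. Var i m l * aa \<alpha> t x (i, l))
          + t * (\<Sum>j\<in>\<alpha> - {i}. \<Sum>l=1..r j. C \<alpha> i j m l * aa \<alpha> t x (j, l))))"
      unfolding G_def using row by (intro sum.cong refl) auto
    also have "\<dots> = aa \<alpha> t x (i, k)
        + (\<Sum>m=1..r i. Wi i k m * (t * (\<Sum>j\<in>\<alpha> - {i}. \<Sum>l=1..r j. C \<alpha> i j m l * aa \<alpha> t x (j, l))))"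
      unfolding distrib_left sum.distrib using Wi_cancel[OF iV k, of "\<lambda>l. aa \<alpha> t x (i, l)"] by simp
    also have "(\<Sum>m=1..r i. Wi i k m * (t * (\<Sum>j\<in>\<alpha> - {i}. \<Sum>l=1..r j. C \<alpha> i j m l * aa \<alpha> t x (j, l))))
        = t * (\<Sum>m=1..r i. \<Sum>j\<in>\<alpha> - {i}. \<Sum>l=1..r j. Wi i k m * C \<alpha> i j m l * aa \<alpha> t x (j, l))"
      by (simp add: sum_distrib_left mult_ac)
    also have "(\<Sum>m=1..r i. \<Sum>j\<in>\<alpha> - {i}. \<Sum>l=1..r j. Wi i k m * C \<alpha> i j m l * aa \<alpha> t x (j, l))
        = (\<Sum>j\<in>\<alpha> - {i}. \<Sum>l=1..r j. edge_weights r Var C \<alpha> j i k l * aa \<alpha> t x (j, l))"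
    proof -
      have "(\<Sum>m=1..r i. \<Sum>j\<in>\<alpha> - {i}. \<Sum>l=1..r j. Wi i k m * C \<alpha> i j m l * aa \<alpha> t x (j, l))
          = (\<Sum>j\<in>\<alpha> - {i}. \<Sum>m=1..r i. \<Sum>l=1..r j. Wi i k m * C \<alpha> i j m l * aa \<alpha> t x (j, l))"
        by (rule sum.swap)
      also have "\<dots> = (\<Sum>j\<in>\<alpha> - {i}. \<Sum>l=1..r j. \<Sum>m=1..r i. Wi i k m * C \<alpha> i j m l * aa \<alpha> t x (j, l))"
        by (rule sum.cong[OF refl]) (rule sum.swap)
      finally show ?thesis by (simp add: edge_weights_def sum_distrib_right Wi_def)
    qed
    finally show ?thesis by simp
  qed
  \<comment> \<open>The matrix of the reduced form at parameter \<open>t\<close>: each inverse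
    factor covariance is padded with zeros to all vertex coordinates, and the vertex terms are added
    as diagonal blocks.\<close>
  define A where "A = (\<lambda>t p q. (\<Sum>\<alpha>\<in>F. if fst p \<in> \<alpha> \<and> fst q \<in> \<alpha> then W \<alpha> t p q else 0)
      + (if fst q = fst p then (1 - d (fst p)) * Wi (fst p) (snd p) (snd q) else 0))"
  have rowA: "(\<Sum>q\<in>J V. A t (i, k) q * x q) = (\<Sum>\<alpha>\<in>{\<alpha>\<in>F. i \<in> \<alpha>}. aa \<alpha> t x (i, k)) + (1 - d i) * G x i k"
    if i: "i \<in> V" for t i k x
  proof -
    have "(\<Sum>q\<in>J V. A t (i, k) q * x q)
      = (\<Sum>q\<in>J V. \<Sum>\<alpha>\<in>F. (if i \<in> \<alpha> \<and> fst q \<in> \<alpha> then W \<alpha> t (i, k) q else 0) * x q)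
        + (\<Sum>q\<in>J V. (if fst q = i then (1 - d i) * Wi i k (snd q) else 0) * x q)"
      by (simp add: A_def distrib_right sum.distrib sum_distrib_right cong: if_cong)
    also have "(\<Sum>q\<in>J V. (if fst q = i then (1 - d i) * Wi i k (snd q) else 0) * x q) = (1 - d i) * G x i k"
      unfolding J_def G_def
      by (subst sum_block_row[OF finV i, where B = "\<lambda>l. (1 - d i) * Wi i k l"])
         (simp add: sum_distrib_left mult.assoc)
    also have "(\<Sum>q\<in>J V. \<Sum>\<alpha>\<in>F. (if i \<in> \<alpha> \<and> fst q \<in> \<alpha> then W \<alpha> t (i, k) q else 0) * x q)
      = (\<Sum>\<alpha>\<in>F. \<Sum>q\<in>J V. (if i \<in> \<alpha> \<and> fst q \<in> \<alpha> then W \<alpha> t (i, k) q else 0) * x q)"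
      by (rule sum.swap)
    also have "\<dots> = (\<Sum>\<alpha>\<in>F. if i \<in> \<alpha> then aa \<alpha> t x (i, k) else 0)"
    proof (intro sum.cong refl)
      fix \<alpha> assume \<alpha>: "\<alpha> \<in> F"
      show "(\<Sum>q\<in>J V. (if i \<in> \<alpha> \<and> fst q \<in> \<alpha> then W \<alpha> t (i, k) q else 0) * x q)
        = (if i \<in> \<alpha> then aa \<alpha> t x (i, k) else 0)"
      proof (cases "i \<in> \<alpha>")
        case True
        have "(\<Sum>q\<in>J \<alpha>. W \<alpha> t (i, k) q * x q)
            = (\<Sum>q\<in>J V. (if i \<in> \<alpha> \<and> fst q \<in> \<alpha> then W \<alpha> t (i, k) q else 0) * x q)"
          using True \<alpha>V[OF \<alpha>] by (intro sum.mono_neutral_cong_left finJ[OF finV]) (auto simp: J_def)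
        then show ?thesis using True by (simp add: aa_def)
      qed simp
    qed
    also have "\<dots> = (\<Sum>\<alpha>\<in>{\<alpha>\<in>F. i \<in> \<alpha>}. aa \<alpha> t x (i, k))"
      using finF by (simp add: sum.inter_filter)
    finally show ?thesis .
  qed
  have quadA: "quad (J V) (A t) x x = (\<Sum>\<alpha>\<in>F. \<Sum>i\<in>\<alpha>. \<Sum>k=1..r i. aa \<alpha> t x (i, k) * x (i, k))
       + (\<Sum>i\<in>V. (1 - d i) * (\<Sum>k=1..r i. G x i k * x (i, k)))" for t x
  proof -
    have "quad (J V) (A t) x x = (\<Sum>i\<in>V. \<Sum>k=1..r i. x (i, k) *
       ((\<Sum>\<alpha>\<in>{\<alpha>\<in>F. i \<in> \<alpha>}. aa \<alpha> t x (i, k)) + (1 - d i) * G x i k))"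
      unfolding quad_apply sumJ[OF finV, of "\<lambda>p. x p * _ p"]
      by (intro sum.cong refl) (simp add: rowA)
    also have "\<dots> = (\<Sum>i\<in>V. \<Sum>k=1..r i. \<Sum>\<alpha>\<in>{\<alpha>\<in>F. i \<in> \<alpha>}. aa \<alpha> t x (i, k) * x (i, k))
       + (\<Sum>i\<in>V. (1 - d i) * (\<Sum>k=1..r i. G x i k * x (i, k)))"
      by (simp add: distrib_left sum.distrib sum_distrib_left mult_ac)
    also have "(\<Sum>i\<in>V. \<Sum>k=1..r i. \<Sum>\<alpha>\<in>{\<alpha>\<in>F. i \<in> \<alpha>}. aa \<alpha> t x (i, k) * x (i, k))
      = (\<Sum>i\<in>V. \<Sum>\<alpha>\<in>{\<alpha>\<in>F. i \<in> \<alpha>}. \<Sum>k=1..r i. aa \<alpha> t x (i, k) * x (i, k))"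
      by (intro sum.cong refl sum.swap)
    also have "\<dots> = (\<Sum>\<alpha>\<in>F. \<Sum>i\<in>{i\<in>V. i \<in> \<alpha>}. \<Sum>k=1..r i. aa \<alpha> t x (i, k) * x (i, k))"
      by (rule sum.swap_restrict[OF finV finF])
    also have "\<dots> = (\<Sum>\<alpha>\<in>F. \<Sum>i\<in>\<alpha>. \<Sum>k=1..r i. aa \<alpha> t x (i, k) * x (i, k))"
      using \<alpha>V by (intro sum.cong refl) auto
    finally show ?thesis .
  qed
  have Gpos: "(\<Sum>k=1..r i. G x i k * x (i, k)) \<ge> 0"
    "k \<in> {1..r i} \<Longrightarrow> x (i, k) \<noteq> 0 \<Longrightarrow> (\<Sum>k=1..r i. G x i k * x (i, k)) > 0" if i: "i \<in> V" for i k x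
  proof -
    have eq: "(\<Sum>k=1..r i. G x i k * x (i, k)) = quad {1..r i} (Var i) (G x i) (G x i)"
      unfolding quad_apply using VarG[OF i] by (intro sum.cong refl) auto
    show "(\<Sum>k=1..r i. G x i k * x (i, k)) \<ge> 0" unfolding eq by (rule pd_on_nonneg[OF Var[OF i]])
    show "(\<Sum>k=1..r i. G x i k * x (i, k)) > 0" if k: "k \<in> {1..r i}" "x (i, k) \<noteq> 0"
    proof -
      have "\<exists>l\<in>{1..r i}. G x i l \<noteq> 0"
      proof (rule ccontr)
        assume "\<not> (\<exists>l\<in>{1..r i}. G x i l \<noteq> 0)"
        then have "(\<Sum>l=1..r i. Var i k l * G x i l) = 0" by (intro sum.neutral) auto
        then show False using VarG[OF i k(1)] k by simp
      qed
      then show ?thesis unfolding eq using pd_on_pos[OF Var[OF i]] by blast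
    qed
  qed
  have card_d: "real (card {\<alpha>\<in>F. i \<in> \<alpha>}) = d i" for i by (simp add: d_def hdegree_def)
  have symA: "A t p q = A t q p" if t: "t \<in> {0..1}" and pq: "p \<in> J V" "q \<in> J V" for t p q
  proof -
    have "(\<Sum>\<alpha>\<in>F. if fst p \<in> \<alpha> \<and> fst q \<in> \<alpha> then W \<alpha> t p q else 0)
        = (\<Sum>\<alpha>\<in>F. if fst q \<in> \<alpha> \<and> fst p \<in> \<alpha> then W \<alpha> t q p else 0)"
      using pq by (intro sum.cong refl) (auto simp: J_def intro!: symW[OF _ t])
    moreover have "(if fst q = fst p then (1 - d (fst p)) * Wi (fst p) (snd p) (snd q) else 0)
        = (if fst p = fst q then (1 - d (fst q)) * Wi (fst q) (snd q) (snd p) else 0)"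
      using pq Wi_sym by (auto simp: J_def)
    ultimately show ?thesis unfolding A_def by linarith
  qed
  have pdA: "pd_on (J V) (A 1)"
  proof (rule pd_on_path)
    show "finite (J V)" by (rule finJ[OF finV])
  next
    show "A t p q = A t q p" if "t \<in> {0..1}" "p \<in> J V" "q \<in> J V" for t p q
      using that by (rule symA)
  next
    fix p q assume pq: "p \<in> J V" "q \<in> J V"
    have "continuous_on {0..1} (\<lambda>t. if fst p \<in> \<alpha> \<and> fst q \<in> \<alpha> then W \<alpha> t p q else 0)" if "\<alpha> \<in> F" for \<alpha>
      using cW[OF that, of p q] pq by (cases "fst p \<in> \<alpha> \<and> fst q \<in> \<alpha>") (auto simp: J_def)
    then show "continuous_on {0..1} (\<lambda>t. A t p q)"
      unfolding A_def by (intro continuous_intros)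
  next
    show "pd_on (J V) (A 0)"
    proof (rule pd_onI)
      show "A 0 p q = A 0 q p" if "p \<in> J V" "q \<in> J V" for p q
        using that by (intro symA) auto
    next
      fix x p assume p: "p \<in> J V" "x p \<noteq> (0::real)"
      \<comment> \<open>At \<open>t = 0\<close> the identity \<open>eqn\<close> reduces to
        \<open>aa = G\<close>. The factors count vertex \<open>i\<close> then \<open>d i\<close>
        times and the vertex term \<open>1 - d i\<close> times, hence once in total.\<close>
      have "quad (J V) (A 0) x x = (\<Sum>\<alpha>\<in>F. \<Sum>i\<in>\<alpha>. \<Sum>k=1..r i. G x i k * x (i, k))
         + (\<Sum>i\<in>V. (1 - d i) * (\<Sum>k=1..r i. G x i k * x (i, k)))"
        unfolding quadA using eqn[of _ 0 _ _ x] by (intro arg_cong2[where f = "(+)"] sum.cong refl) auto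
      also have "(\<Sum>\<alpha>\<in>F. \<Sum>i\<in>\<alpha>. \<Sum>k=1..r i. G x i k * x (i, k))
          = (\<Sum>\<alpha>\<in>F. \<Sum>i\<in>{i\<in>V. i \<in> \<alpha>}. \<Sum>k=1..r i. G x i k * x (i, k))"
        using \<alpha>V by (intro sum.cong refl) auto
      also have "\<dots> = (\<Sum>i\<in>V. \<Sum>\<alpha>\<in>{\<alpha>\<in>F. i \<in> \<alpha>}. \<Sum>k=1..r i. G x i k * x (i, k))"
        by (rule sum.swap_restrict[OF finF finV])
      also have "\<dots> = (\<Sum>i\<in>V. d i * (\<Sum>k=1..r i. G x i k * x (i, k)))"
        by (simp add: card_d)
      also have "\<dots> + (\<Sum>i\<in>V. (1 - d i) * (\<Sum>k=1..r i. G x i k * x (i, k)))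
          = (\<Sum>i\<in>V. (\<Sum>k=1..r i. G x i k * x (i, k)))"
        by (simp add: sum.distrib[symmetric] algebra_simps)
      also have "\<dots> > 0"
        by (rule sum_pos2[OF finV, of "fst p"]) (use p Gpos in \<open>auto simp: J_def\<close>)
      finally show "quad (J V) (A 0) x x > 0" .
    qed
  next
    fix t :: real and x p
    assume t: "t \<in> {0<..1}" and row0: "\<And>p. p \<in> J V \<Longrightarrow> (\<Sum>q\<in>J V. A t p q * x q) = 0" and p: "p \<in> J V"
    have t': "t \<in> {0..1}" using t by auto
    \<comment> \<open>The value 0 outside the index range places \<open>f\<close> in
      \<open>edge_space\<close>.\<close>
    define f where "f = (\<lambda>e k. if e \<in> dedges F \<and> k \<in> {1..r (snd e)}
        then G x (snd e) k - aa (fst e) t x (snd e, k) else 0)"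
    have fE: "f (\<alpha>, i) k = G x i k - aa \<alpha> t x (i, k)"
      if "\<alpha> \<in> F" "i \<in> \<alpha>" "k \<in> {1..r i}" for \<alpha> i k
      using that by (simp add: f_def dedges_def)
    \<comment> \<open>The kernel row makes the sum of the \<open>aa\<close> terms equal to
      \<open>(d i - 1) * G x i k\<close>; the messages sum to \<open>d i * G x i k\<close> minus
      this.\<close>
    have sumf: "(\<Sum>\<beta>\<in>{\<beta>\<in>F. i \<in> \<beta>}. f (\<beta>, i) k) = G x i k" if "i \<in> V" "k \<in> {1..r i}" for i k
    proof -
      have "(\<Sum>\<beta>\<in>{\<beta>\<in>F. i \<in> \<beta>}. f (\<beta>, i) k) = d i * G x i k - (\<Sum>\<beta>\<in>{\<beta>\<in>F. i \<in> \<beta>}. aa \<beta> t x (i, k))"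
        using that by (simp add: fE sum_subtractf card_d)
      then show ?thesis using rowA[OF that(1), of t k x] row0[of "(i, k)"] that
        by (simp add: J_def algebra_simps)
    qed
    \<comment> \<open>Dropping the message of \<alpha> leaves \<open>G - f = aa\<close>. The
      operator forms exactly this sum, because a feeding edge must have a different source.\<close>
    have sumf': "(\<Sum>\<beta>\<in>{\<beta>\<in>F. i \<in> \<beta>} - {\<alpha>}. f (\<beta>, i) k) = aa \<alpha> t x (i, k)"
      if "\<alpha> \<in> F" "i \<in> \<alpha>" "k \<in> {1..r i}" for \<alpha> i k
      using sumf[of i k] that \<alpha>V[OF that(1)] finF fE[OF that]
      by (subst sum_diff1) auto
    have f_eigen: "f (\<alpha>, i) k = t * (\<Sum>e' | e' \<in> dedges F \<and> e' \<rightharpoonup> (\<alpha>, i).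
          \<Sum>l=1..r (snd e'). edge_weights r Var C \<alpha> (snd e') i k l * f e' l)"
      if \<alpha>: "\<alpha> \<in> F" and i: "i \<in> \<alpha>" and k: "k \<in> {1..r i}" for \<alpha> i k
    proof -
      have "(\<Sum>e' | e' \<in> dedges F \<and> e' \<rightharpoonup> (\<alpha>, i).
              \<Sum>l=1..r (snd e'). edge_weights r Var C \<alpha> (snd e') i k l * f e' l)
          = (\<Sum>j\<in>\<alpha> - {i}. \<Sum>\<beta>\<in>{\<beta>\<in>F. j \<in> \<beta>} - {\<alpha>}. \<Sum>l=1..r j. edge_weights r Var C \<alpha> j i k l * f (\<beta>, j) l)"
        unfolding sum_dedges_feeding[OF finF \<alpha> i fin\<alpha>[OF \<alpha>]] by simp
      also have "\<dots> = (\<Sum>j\<in>\<alpha> - {i}. \<Sum>l=1..r j. edge_weights r Var C \<alpha> j i k l *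
            (\<Sum>\<beta>\<in>{\<beta>\<in>F. j \<in> \<beta>} - {\<alpha>}. f (\<beta>, j) l))"
        unfolding sum_distrib_left by (intro sum.cong refl sum.swap)
      also have "\<dots> = (\<Sum>j\<in>\<alpha> - {i}. \<Sum>l=1..r j. edge_weights r Var C \<alpha> j i k l * aa \<alpha> t x (j, l))"
        using sumf'[OF \<alpha>] by (intro sum.cong refl) auto
      finally show ?thesis using eqn[OF \<alpha> t' i k, of x] fE[OF \<alpha> i k] by simp
    qed
    have f0: "f = (\<lambda>e k. 0)"
    proof (rule ccontr)
      assume fnz: "f \<noteq> (\<lambda>e k. 0)"
      \<comment> \<open>Eigenvalues refer to the complexified operator, so the real messages are
        embedded as a complex eigenvector.\<close>
      define h where "h = (\<lambda>e k. complex_of_real (f e k))"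
      have "edge_op_eigenvalue F r (edge_weights r Var C) (complex_of_real (1 / t))"
        unfolding edge_op_eigenvalue_def
      proof (intro bexI[of _ h] conjI)
        show "h \<in> edge_space F r" by (auto simp: h_def edge_space_def f_def)
        show "h \<noteq> (\<lambda>e k. 0)" using fnz by (auto simp: h_def fun_eq_iff)
        show "edge_op F r (edge_weights r Var C) h = (\<lambda>e k. complex_of_real (1 / t) * h e k)"
        proof (intro ext)
          fix e k
          show "edge_op F r (edge_weights r Var C) h e k = complex_of_real (1 / t) * h e k"
          proof (cases "e \<in> dedges F \<and> k \<in> {1..r (snd e)}")
            case True
            then obtain \<alpha> i where e: "e = (\<alpha>, i)" "\<alpha> \<in> F" "i \<in> \<alpha>" "k \<in> {1..r i}"
              by (auto simp: dedges_def)
            have "edge_op F r (edge_weights r Var C) h e k = complex_of_real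
               (\<Sum>e' | e' \<in> dedges F \<and> e' \<rightharpoonup> (\<alpha>, i).
                  \<Sum>l=1..r (snd e'). edge_weights r Var C \<alpha> (snd e') i k l * f e' l)"
              using True e by (simp add: edge_op_def h_def scaleR_conv_of_real)
            also have "\<dots> = complex_of_real (1 / t) * h e k"
              using f_eigen[OF e(2-4)] t unfolding h_def e(1) of_real_mult[symmetric] by simp
            finally show ?thesis .
          next
            case False
            then show ?thesis by (auto simp: edge_op_def h_def f_def)
          qed
        qed
      qed
      moreover have "complex_of_real (1 / t) \<in> complex_of_real ` {1..}"
        using t by (intro imageI) simp
      ultimately show False using eig by blast
    qed
    \<comment> \<open>With all messages zero, \<open>sumf\<close> gives \<open>G x = 0\<close>, and
      applying \<open>Var i\<close> recovers \<open>x = 0\<close>.\<close>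
    obtain i k where ik: "p = (i, k)" "i \<in> V" "k \<in> {1..r i}" using p by (auto simp: J_def)
    have "G x i l = 0" if "l \<in> {1..r i}" for l using sumf[OF ik(2) that] f0 by simp
    then have "(\<Sum>l=1..r i. Var i k l * G x i l) = 0" by (intro sum.neutral) auto
    then show "x p = 0" using VarG[OF ik(2,3)] ik(1) by simp
  qed
  define x where "x = (\<lambda>p. y (fst p) (snd p))"
  have g: "g i k = G x i k" if "i \<in> V" "k \<in> {1..r i}" for i k
    using Wi_cancel[OF that, of "g i"] gy[OF that(1)] by (simp add: G_def x_def)
  have "0 < quad (J V) (A 1) x x"
    using nz by (intro pd_on_pos[OF pdA, of "(i0, k0)"]) (auto simp: J_def x_def)
  also have "\<dots> = (\<Sum>\<alpha>\<in>F. 2 * (\<Sum>i\<in>\<alpha>. \<Sum>k=1..r i. aa \<alpha> 1 x (i, k) * y i k)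
                  - quad (SIGMA i:\<alpha>. {1..r i}) (K \<alpha>) (aa \<alpha> 1 x) (aa \<alpha> 1 x))
            + (\<Sum>i\<in>V. (1 - real (hdegree F i)) * (\<Sum>k=1..r i. g i k * y i k))"
  proof -
    \<comment> \<open>At \<open>t = 1\<close> the multiplier is the inverse of
      \<open>K \<alpha>\<close> applied to \<open>y\<close>, so \<open>2 a \<cdot> y - a K a\<close>
      collapses to \<open>a \<cdot> y\<close>, the factor term in \<open>quadA\<close>.\<close>
    have "quad (SIGMA i:\<alpha>. {1..r i}) (K \<alpha>) (aa \<alpha> 1 x) (aa \<alpha> 1 x)
        = (\<Sum>i\<in>\<alpha>. \<Sum>k=1..r i. aa \<alpha> 1 x (i, k) * y i k)" if \<alpha>: "\<alpha> \<in> F" for \<alpha>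
    proof -
      have "quad (J \<alpha>) (K \<alpha>) (aa \<alpha> 1 x) (aa \<alpha> 1 x) = (\<Sum>p\<in>J \<alpha>. aa \<alpha> 1 x p * x p)"
        unfolding quad_apply using aa[OF \<alpha>, of 1 _ x]
        by (intro sum.cong refl) (simp add: Kt_def)
      then show ?thesis using sumJ[OF fin\<alpha>[OF \<alpha>]] by (simp add: J_def x_def)
    qed
    then show ?thesis unfolding quadA
      by (intro arg_cong2[where f = "(+)"] sum.cong refl) (auto simp: x_def d_def g)
  qed
  finally show ?thesis by (intro exI[of _ "\<lambda>\<alpha>. aa \<alpha> 1 x"])
qed

section \<open>Hessians in affine coordinates\<close>

text \<open>Points of \<open>coord_space m\<close> agree from index \<open>m\<close> on, so only
  finitely many coordinates of a basic open set of the product topology impose a condition.\<close>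

lemma open_box_coord_space:
  assumes "open U" "t \<in> U" "t \<in> coord_space m"
  shows "\<exists>\<epsilon>>0. \<forall>s\<in>coord_space m. (\<forall>i<m. \<bar>s i - t i\<bar> < \<epsilon>) \<longrightarrow> s \<in> U"
proof -
  have "openin (product_topology (\<lambda>i. euclidean) UNIV) U"
    using assms(1) by (simp add: euclidean_product_topology)
  from product_topology_open_contains_basis[OF this assms(2)]
  obtain X where X: "t \<in> Pi\<^sub>E UNIV X" "\<And>i. open (X i)" "Pi\<^sub>E UNIV X \<subseteq> U"
    by auto
  have "\<forall>i. \<exists>e>0. \<forall>y. \<bar>y - t i\<bar> < e \<longrightarrow> y \<in> X i"
  proof
    fix i
    have "t i \<in> X i" using X(1) by auto
    with X(2)[of i] show "\<exists>e>0. \<forall>y. \<bar>y - t i\<bar> < e \<longrightarrow> y \<in> X i"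
      by (simp add: open_dist dist_real_def)
  qed
  then obtain e where e: "\<And>i. e i > 0" "\<And>i y. \<bar>y - t i\<bar> < e i \<Longrightarrow> y \<in> X i" by metis
  \<comment> \<open>The inserted 1 keeps the minimum defined when \<open>m = 0\<close>.\<close>
  define \<epsilon> where "\<epsilon> = Min (insert 1 (e ` {..<m}))"
  have "\<epsilon> > 0" unfolding \<epsilon>_def using e(1) by (subst Min_gr_iff) auto
  moreover have "s \<in> U" if s: "s \<in> coord_space m" "\<forall>i<m. \<bar>s i - t i\<bar> < \<epsilon>" for s
  proof -
    have "s i \<in> X i" for i
    proof (cases "i < m")
      case True
      then have "\<epsilon> \<le> e i" unfolding \<epsilon>_def by (intro Min_le) auto
      then show ?thesis using s(2) True by (intro e(2)) force
    next
      case False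
      then have "s i = t i" using s(1) assms(3) by (simp add: coord_space_def)
      then show ?thesis using X(1) by auto
    qed
    then show ?thesis using X(3) by auto
  qed
  ultimately show ?thesis by blast
qed

lemma affine_map_upd:
  assumes "j < m"
  shows "affine_map m p w (s(j := \<tau>)) = affine_map m p w s + (\<tau> - s j) *\<^sub>R w j"
proof -
  have "(\<Sum>i<m. (s(j := \<tau>)) i *\<^sub>R w i) = (\<Sum>i<m. s i *\<^sub>R w i + (if i = j then (\<tau> - s j) *\<^sub>R w j else 0))"
    by (intro sum.cong refl) (auto simp: scaleR_diff_left)
  then show ?thesis using assms by (simp add: affine_map_def sum.distrib)
qed

lemma has_partial_derivative_affine_map:
  assumes "j < m" and "((\<lambda>\<tau>. f (affine_map m p w s + \<tau> *\<^sub>R w j)) has_real_derivative D) (at 0)"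
  shows "has_partial_derivative (\<lambda>s. f (affine_map m p w s)) j D s"
proof -
  have "((\<lambda>\<tau>. f (affine_map m p w s + (\<tau> - s j) *\<^sub>R w j)) has_real_derivative D) (at (s j))"
    using DERIV_shift[of "\<lambda>\<tau>. f (affine_map m p w s + (\<tau> - s j) *\<^sub>R w j)" D 0 "s j"] assms(2) by simp
  then show ?thesis
    unfolding has_partial_derivative_def affine_map_upd[OF assms(1)] .
qed

text \<open>Reduces the claim for all affine coordinates to derivatives along lines: the Hessian
  entries are \<open>Q (w i) (w j)\<close>. Injectivity of the coordinates makes the directions
  \<open>w i\<close> independent, and they span directions inside \<open>T\<close>, where
  \<open>Q\<close> is positive. The type of points carries no topology, so openness of
  \<open>U\<close> is expressed after pulling back along affine maps.\<close>

lemma hessian_positive_definiteI: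
  fixes \<Phi> :: "'p::real_vector \<Rightarrow> real"
  assumes T: "subspace T" and LT: "\<And>q. q \<in> L \<Longrightarrow> q - \<eta> \<in> T"
    and \<eta>: "\<eta> \<in> U" and openU: "\<And>m p w. open {s. affine_map m p w s \<in> U}"
    and D: "\<And>q v. q \<in> U \<Longrightarrow> ((\<lambda>\<tau>. \<Phi> (q + \<tau> *\<^sub>R v)) has_real_derivative D q v) (at 0)"
    and Q: "\<And>v w. ((\<lambda>\<tau>. D (\<eta> + \<tau> *\<^sub>R w) v) has_real_derivative Q w v) (at 0)"
    and linQ: "\<And>w. linear (Q w)" and symQ: "\<And>v w. Q v w = Q w v"
    and posQ: "\<And>v. v \<in> T \<Longrightarrow> v \<noteq> 0 \<Longrightarrow> Q v v > 0"
  shows "hessian_positive_definite L \<Phi> \<eta>"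
  unfolding hessian_positive_definite_def
proof (intro allI impI, elim conjE)
  fix m p w t
  assume coords: "affine_coordinates L m p w" and t: "t \<in> coord_space m" and \<eta>t: "affine_map m p w t = \<eta>"
  have "affine hull L \<subseteq> {q. q - \<eta> \<in> T}"
  proof (rule hull_minimal)
    show "L \<subseteq> {q. q - \<eta> \<in> T}" using LT by blast
    show "affine {q. q - \<eta> \<in> T}"
      unfolding affine_def
    proof clarify
      fix x y and u v :: real assume xy: "x - \<eta> \<in> T" "y - \<eta> \<in> T" and uv: "u + v = 1"
      have "u *\<^sub>R x + v *\<^sub>R y - \<eta> = u *\<^sub>R x + v *\<^sub>R y - (u + v) *\<^sub>R \<eta>" using uv by simp
      also have "\<dots> = u *\<^sub>R (x - \<eta>) + v *\<^sub>R (y - \<eta>)"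
        by (simp add: algebra_simps)
      finally show "u *\<^sub>R x + v *\<^sub>R y - \<eta> \<in> T"
        using xy T by (simp add: subspace_add subspace_scale)
    qed
  qed
  moreover have bij: "bij_betw (affine_map m p w) (coord_space m) (affine hull L)"
    using coords by (simp add: affine_coordinates_def)
  ultimately have inT: "affine_map m p w s - \<eta> \<in> T" if "s \<in> coord_space m" for s
    using that by (auto dest: bij_betwE)
  have diff: "affine_map m p w (\<lambda>i. t i + x i) - \<eta> = (\<Sum>i<m. x i *\<^sub>R w i)" for x
    unfolding \<eta>t[symmetric] by (simp add: affine_map_def scaleR_add_left sum.distrib)
  have comb: "(\<Sum>i<m. x i *\<^sub>R w i) \<in> T \<and> ((\<exists>i<m. x i \<noteq> 0) \<longrightarrow> (\<Sum>i<m. x i *\<^sub>R w i) \<noteq> 0)" for x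
  proof -
    \<comment> \<open>Truncation keeps \<open>t + x'\<close> inside \<open>coord_space m\<close>,
      where injectivity is available, and does not change the combination.\<close>
    define x' where "x' = (\<lambda>i. if i < m then x i else 0)"
    have eq: "(\<Sum>i<m. x i *\<^sub>R w i) = (\<Sum>i<m. x' i *\<^sub>R w i)" by (simp add: x'_def)
    have mem: "(\<lambda>i. t i + x' i) \<in> coord_space m" using t by (simp add: coord_space_def x'_def)
    have "(\<Sum>i<m. x' i *\<^sub>R w i) \<noteq> 0" if "i < m" "x i \<noteq> 0" for i
    proof
      assume "(\<Sum>i<m. x' i *\<^sub>R w i) = 0"
      then have "affine_map m p w (\<lambda>i. t i + x' i) = affine_map m p w t"
        using diff[of x'] \<eta>t by simp
      then have "(\<lambda>i. t i + x' i) = t"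
        using bij mem t by (auto simp: bij_betw_def inj_on_def)
      then have "x' i = 0" by (auto simp: fun_eq_iff)
      then show False using that by (simp add: x'_def)
    qed
    then show ?thesis unfolding eq using inT[OF mem] diff[of x'] by auto
  qed
  define A where "A = (\<lambda>i j. Q (w i) (w j))"
  show "\<exists>A. has_hessian m (\<lambda>s. \<Phi> (affine_map m p w s)) t A \<and> pos_def_matrix m A"
  proof (intro exI conjI)
    show "has_hessian m (\<lambda>s. \<Phi> (affine_map m p w s)) t A"
      unfolding has_hessian_def
    proof (intro exI[of _ "\<lambda>j s. D (affine_map m p w s) (w j)"] conjI allI impI)
      have "\<exists>\<epsilon>>0. \<forall>s\<in>coord_space m. (\<forall>i<m. \<bar>s i - t i\<bar> < \<epsilon>) \<longrightarrow> s \<in> {s. affine_map m p w s \<in> U}"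
        using t \<eta> \<eta>t by (intro open_box_coord_space openU) auto
      then show "\<exists>\<epsilon>>0. \<forall>s\<in>coord_space m. (\<forall>i<m. \<bar>s i - t i\<bar> < \<epsilon>) \<longrightarrow>
          (\<forall>j<m. has_partial_derivative (\<lambda>s. \<Phi> (affine_map m p w s)) j (D (affine_map m p w s) (w j)) s)"
        using has_partial_derivative_affine_map[OF _ D] by (metis mem_Collect_eq)
      show "has_partial_derivative (\<lambda>s. D (affine_map m p w s) (w j)) i (A i j) t" if "i < m" "j < m" for i j
        unfolding A_def
        by (rule has_partial_derivative_affine_map[OF that(1), of "\<lambda>q. D q (w j)"]) (simp add: \<eta>t Q)
    qed
    show "pos_def_matrix m A"
      unfolding pos_def_matrix_def
    proof (intro conjI allI impI)
      show "A i j = A j i" for i j unfolding A_def by (rule symQ)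
    next
      fix x :: "nat \<Rightarrow> real" assume x: "\<exists>i<m. x i \<noteq> 0"
      have lin: "Q q (\<Sum>i<m. x i *\<^sub>R w i) = (\<Sum>i<m. x i * Q q (w i))" for q
        by (simp add: linear_sum[OF linQ] linear_scale[OF linQ])
      have "Q (\<Sum>i<m. x i *\<^sub>R w i) (\<Sum>i<m. x i *\<^sub>R w i) = (\<Sum>i<m. x i * Q (\<Sum>i<m. x i *\<^sub>R w i) (w i))"
        by (rule lin)
      also have "\<dots> = (\<Sum>i<m. x i * (\<Sum>j<m. x j * Q (w i) (w j)))"
        by (simp add: symQ[of "\<Sum>i<m. x i *\<^sub>R w i"] lin)
      also have "\<dots> = (\<Sum>i<m. \<Sum>j<m. x i * A i j * x j)"
        by (simp add: A_def sum_distrib_left mult_ac)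
      finally have eq: "Q (\<Sum>i<m. x i *\<^sub>R w i) (\<Sum>i<m. x i *\<^sub>R w i) = (\<Sum>i<m. \<Sum>j<m. x i * A i j * x j)" .
      have "Q (\<Sum>i<m. x i *\<^sub>R w i) (\<Sum>i<m. x i *\<^sub>R w i) > 0"
        using posQ comb[of x] x by blast
      then show "(\<Sum>i<m. \<Sum>j<m. x i * A i j * x j) > 0" unfolding eq .
    qed
  qed
qed

section \<open>Multinomial families\<close>

lemma cov_point_measure:
  assumes "finite X" "\<And>x. x \<in> X \<Longrightarrow> p x \<ge> 0"
  shows "cov (point_measure X (\<lambda>x. ennreal (p x))) f g
           = (\<Sum>x\<in>X. p x * ((f x - (\<Sum>y\<in>X. p y * f y)) * (g x - (\<Sum>y\<in>X. p y * g y))))"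
  unfolding cov_def by (simp add: lebesgue_integral_point_measure_finite[OF assms])

text \<open>With \<open>b\<close> a probability function and \<open>m\<close> the means, the right
  side is the variance of the linear statistic with coefficients \<open>a\<close>.\<close>

lemma quad_covariance:
  assumes K: "\<And>p q. p \<in> J \<Longrightarrow> q \<in> J \<Longrightarrow>
      K p q = (\<Sum>x\<in>X. b x * ((\<phi> p x - m p) * (\<phi> q x - m q)))"
  shows "quad J K a a = (\<Sum>x\<in>X. b x * (\<Sum>p\<in>J. a p * (\<phi> p x - m p))\<^sup>2)"
proof -
  have "quad J K a a = (\<Sum>p\<in>J. \<Sum>q\<in>J. \<Sum>x\<in>X. b x * (a p * (\<phi> p x - m p) * (a q * (\<phi> q x - m q))))"
    unfolding quad_def by (intro sum.cong refl) (simp add: K sum_distrib_left sum_distrib_right mult_ac)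
  also have "\<dots> = (\<Sum>p\<in>J. \<Sum>x\<in>X. \<Sum>q\<in>J. b x * (a p * (\<phi> p x - m p) * (a q * (\<phi> q x - m q))))"
    by (rule sum.cong[OF refl]) (rule sum.swap)
  also have "\<dots> = (\<Sum>x\<in>X. \<Sum>p\<in>J. \<Sum>q\<in>J. b x * (a p * (\<phi> p x - m p) * (a q * (\<phi> q x - m q))))"
    by (rule sum.swap)
  also have "\<dots> = (\<Sum>x\<in>X. b x * (\<Sum>p\<in>J. a p * (\<phi> p x - m p))\<^sup>2)"
    unfolding power2_eq_square sum_product by (simp only: sum_distrib_left)
  finally show ?thesis .
qed

text \<open>All weights are positive, so a vanishing variance forces the linear statistic to be
  constant on \<open>X\<close>; \<open>indep\<close> says that only zero coefficients achieve
  that.\<close>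

lemma pd_on_covariance:
  assumes finX: "finite X" and b: "\<And>x. x \<in> X \<Longrightarrow> b x > 0"
    and K: "\<And>p q. p \<in> J \<Longrightarrow> q \<in> J \<Longrightarrow>
      K p q = (\<Sum>x\<in>X. b x * ((\<phi> p x - m p) * (\<phi> q x - m q)))"
    and indep: "\<And>a c p. (\<And>x. x \<in> X \<Longrightarrow> (\<Sum>p\<in>J. a p * \<phi> p x) = c) \<Longrightarrow> p \<in> J \<Longrightarrow> a p = 0"
  shows "pd_on J K"
proof (rule pd_onI)
  show "K p q = K q p" if "p \<in> J" "q \<in> J" for p q
    using that by (simp add: K mult_ac)
next
  fix a :: "_ \<Rightarrow> real" and p assume p: "p \<in> J" "a p \<noteq> 0"
  define h where "h = (\<lambda>x. \<Sum>p\<in>J. a p * (\<phi> p x - m p))"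
  have "\<exists>x\<in>X. h x \<noteq> 0"
  proof (rule ccontr)
    assume "\<not> (\<exists>x\<in>X. h x \<noteq> 0)"
    then have "(\<Sum>p\<in>J. a p * \<phi> p x) = (\<Sum>p\<in>J. a p * m p)" if "x \<in> X" for x
      using that by (simp add: h_def right_diff_distrib sum_subtractf)
    from indep[OF this p(1)] p(2) show False by blast
  qed
  then obtain x where "x \<in> X" "h x \<noteq> 0" by blast
  then have "(\<Sum>x\<in>X. b x * (h x)\<^sup>2) > 0"
    using b by (intro sum_pos2[OF finX, of x]) (auto simp: less_imp_le)
  then show "quad J K a a > 0"
    using quad_covariance[of J K, OF K, where a = a] by (simp add: h_def)
qed

lemma finite_states: "finite \<alpha> \<Longrightarrow> finite (states N \<alpha>)"
  unfolding states_def by (intro finite_PiE) auto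

lemma sum_states_marginal:
  fixes f :: "('v \<Rightarrow> nat) \<Rightarrow> real"
  assumes "finite \<alpha>" "i \<in> \<alpha>"
    and marg: "\<And>y. y \<in> {1..N i} \<Longrightarrow> (\<Sum>x | x \<in> states N \<alpha> \<and> x i = y. f x) = g y"
  shows "(\<Sum>x\<in>states N \<alpha>. f x * h (x i)) = (\<Sum>y=1..N i. g y * h y)"
proof -
  have "(\<Sum>y=1..N i. g y * h y) = (\<Sum>y=1..N i. \<Sum>x | x \<in> states N \<alpha> \<and> x i = y. f x * h (x i))"
  proof (rule sum.cong[OF refl])
    fix y assume "y \<in> {1..N i}"
    have "(\<Sum>x | x \<in> states N \<alpha> \<and> x i = y. f x * h (x i)) = (\<Sum>x | x \<in> states N \<alpha> \<and> x i = y. f x * h y)"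
      by (intro sum.cong refl) auto
    also have "\<dots> = g y * h y"
      unfolding sum_distrib_right[symmetric] marg[OF \<open>y \<in> {1..N i}\<close>] ..
    finally show "g y * h y = (\<Sum>x | x \<in> states N \<alpha> \<and> x i = y. f x * h (x i))" ..
  qed
  also have "\<dots> = (\<Sum>x\<in>states N \<alpha>. f x * h (x i))"
    by (rule sum.group) (use assms finite_states in \<open>auto simp: states_def\<close>)
  finally show ?thesis ..
qed

text \<open>In the state where every vertex takes its last value \<open>N i\<close>, all the
  statistics vanish, because their indices stop at \<open>N i - 1\<close>. Moving the single vertex
  \<open>i\<close> to \<open>k\<close> switches on exactly the statistic \<open>(i, k)\<close>, so
  its coefficient is the difference of two equal sums.\<close>

lemma multinomial_phi_independent:
  assumes fin: "finite \<alpha>" and N: "\<And>i. i \<in> \<alpha> \<Longrightarrow> N i \<ge> 1"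
    and const: "\<And>x. x \<in> states N \<alpha> \<Longrightarrow>
      (\<Sum>p\<in>(SIGMA i:\<alpha>. {1..N i - 1}). a p * multinomial_phi (snd p) (x (fst p))) = c"
    and p: "p \<in> (SIGMA i:\<alpha>. {1..N i - 1})"
  shows "a p = 0"
proof -
  obtain i k where ik: "p = (i, k)" "i \<in> \<alpha>" "k \<in> {1..N i - 1}" using p by auto
  define x0 where "x0 = restrict N \<alpha>"
  define x1 where "x1 = x0(i := k)"
  have "x0 \<in> states N \<alpha>" using N by (auto simp: states_def x0_def)
  moreover have "x1 \<in> states N \<alpha>" using N ik
    by (auto simp: states_def x0_def x1_def PiE_iff extensional_def)
  ultimately have
    eq: "(\<Sum>p\<in>(SIGMA i:\<alpha>. {1..N i - 1}). a p * multinomial_phi (snd p) (x1 (fst p)))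
       = (\<Sum>p\<in>(SIGMA i:\<alpha>. {1..N i - 1}). a p * multinomial_phi (snd p) (x0 (fst p)))"
    using const by simp
  have "(\<Sum>p\<in>(SIGMA i:\<alpha>. {1..N i - 1}). a p * multinomial_phi (snd p) (x0 (fst p))) = 0"
    by (intro sum.neutral) (auto simp: multinomial_phi_def x0_def)
  moreover have "(\<Sum>p\<in>(SIGMA i:\<alpha>. {1..N i - 1}). a p * multinomial_phi (snd p) (x1 (fst p)))
      = (\<Sum>q\<in>(SIGMA i:\<alpha>. {1..N i - 1}). if q = p then a p else 0)"
    by (intro sum.cong refl) (auto simp: multinomial_phi_def x1_def x0_def ik(1))
  moreover have "\<dots> = a p" using fin p by (subst sum.delta) auto
  ultimately show ?thesis using eq by simp
qed

section \<open>The Hessian of the multinomial Bethe free energy\<close>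

lemma entropy_has_derivative:
  fixes a v :: real
  assumes "a > 0"
  shows "((\<lambda>\<tau>. (a + \<tau> * v) * ln (a + \<tau> * v)) has_real_derivative (v * ln a + v)) (at 0)"
  using assms by (auto intro!: derivative_eq_intros)

lemma multinomial_hessian_positive_definite:
  fixes V :: "'v set" and \<eta> :: "'v multinomial_point"
  assumes H: "hypergraph V F" and N: "\<And>i. i \<in> V \<Longrightarrow> N i \<ge> 1"
    and \<eta>: "\<eta> \<in> multinomial_L V F N"
    and eig: "\<And>z. edge_op_eigenvalue F (multinomial_dim N) (multinomial_u N \<eta>) z \<Longrightarrow>
             z \<notin> complex_of_real ` {1..}"
  shows "hessian_positive_definite (multinomial_L V F N) (multinomial_bethe V F N \<Psi>) \<eta>"
proof -
  obtain bF bV where \<eta>_eq: "\<eta> = (bF, bV)" by (cases \<eta>)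
  have finV: "finite V" and FV: "F \<subseteq> Pow V" using H by (auto simp: hypergraph_def)
  have finF: "finite F" using finV FV by (rule rev_finite_subset[OF finite_Pow_iff[THEN iffD2]])
  have fin\<alpha>: "finite \<alpha>" and \<alpha>V: "\<alpha> \<subseteq> V" if "\<alpha> \<in> F" for \<alpha>
    using that FV finV by (auto intro: finite_subset)
  have bF: "bF \<alpha> x > 0" if "\<alpha> \<in> F" "x \<in> states N \<alpha>" for \<alpha> x
    using \<eta> that by (simp add: \<eta>_eq multinomial_L_def)
  have bV: "bV i x > 0" "(\<Sum>x=1..N i. bV i x) = 1" if "i \<in> V" "x \<in> {1..N i}" for i x
    using \<eta> that by (simp_all add: \<eta>_eq multinomial_L_def)
  have bmarg: "(\<Sum>x | x \<in> states N \<alpha> \<and> x i = y. bF \<alpha> x) = bV i y"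
    if "\<alpha> \<in> F" "i \<in> \<alpha>" "y \<in> {1..N i}" for \<alpha> i y
    using \<eta> that by (simp add: \<eta>_eq multinomial_L_def)
  define r where "r = multinomial_dim N"
  have r: "r i = N i - 1" for i by (simp add: r_def multinomial_dim_def)
  \<comment> \<open>The constraints of \<open>multinomial_L\<close> made homogeneous: total mass 1
    becomes 0, positivity is dropped.\<close>
  define T :: "'v multinomial_point set" where "T = {(hF, hV).
     (\<forall>\<alpha>\<in>F. (\<Sum>x\<in>states N \<alpha>. hF \<alpha> x) = 0) \<and>
     (\<forall>i\<in>V. (\<Sum>x = 1..N i. hV i x) = 0) \<and>
     (\<forall>\<alpha>\<in>F. \<forall>i\<in>\<alpha>. \<forall>y\<in>{1..N i}. (\<Sum>x | x \<in> states N \<alpha> \<and> x i = y. hF \<alpha> x) = hV i y) \<and>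
     (\<forall>\<alpha> x. \<not> (\<alpha> \<in> F \<and> x \<in> states N \<alpha>) \<longrightarrow> hF \<alpha> x = 0) \<and>
     (\<forall>i x. \<not> (i \<in> V \<and> x \<in> {1..N i}) \<longrightarrow> hV i x = 0)}"
  \<comment> \<open>Positivity alone is kept, so derivatives exist in all directions; the linear
    constraints enter only through \<open>T\<close>.\<close>
  define U where "U = {q :: 'v multinomial_point. (\<forall>\<alpha>\<in>F. \<forall>x\<in>states N \<alpha>. fst q \<alpha> x > 0) \<and>
     (\<forall>i\<in>V. \<forall>x\<in>{1..N i}. snd q i x > 0)}"
  define D where "D = (\<lambda>q v :: 'v multinomial_point.
     - (\<Sum>\<alpha>\<in>F. \<Sum>x\<in>states N \<alpha>. fst v \<alpha> x * ln (\<Psi> \<alpha> x))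
     + (\<Sum>\<alpha>\<in>F. \<Sum>x\<in>states N \<alpha>. fst v \<alpha> x * ln (fst q \<alpha> x) + fst v \<alpha> x)
     + (\<Sum>i\<in>V. (1 - real (hdegree F i)) * (\<Sum>x = 1..N i. snd v i x * ln (snd q i x) + snd v i x)))"
  define Q where "Q = (\<lambda>w v :: 'v multinomial_point.
     (\<Sum>\<alpha>\<in>F. \<Sum>x\<in>states N \<alpha>. fst w \<alpha> x * fst v \<alpha> x / bF \<alpha> x)
     + (\<Sum>i\<in>V. (1 - real (hdegree F i)) * (\<Sum>x = 1..N i. snd w i x * snd v i x / bV i x)))"
  have line: "fst (q + \<tau> *\<^sub>R v) \<alpha> x = fst q \<alpha> x + \<tau> * fst v \<alpha> x"
    "snd (q + \<tau> *\<^sub>R v) i k = snd q i k + \<tau> * snd v i k"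
    for q v :: "'v multinomial_point" and \<tau> \<alpha> x i k
    by (simp_all add: scaleR_fun_def)
  show ?thesis
  proof (rule hessian_positive_definiteI[where T = T and U = U and D = D and Q = Q])
    show "subspace T"
      unfolding subspace_def T_def
      by (auto simp: sum.distrib scaleR_fun_def sum_distrib_left[symmetric] zero_prod_def)
    show "q - \<eta> \<in> T" if "q \<in> multinomial_L V F N" for q
      using that \<eta> unfolding \<eta>_eq T_def multinomial_L_def
      by (auto simp: sum_subtractf)
    show "\<eta> \<in> U" using bF bV(1) by (auto simp: U_def \<eta>_eq)
    show "open {s. affine_map m p w s \<in> U}" for m p w
    proof -
      have cF: "continuous_on UNIV (\<lambda>s. fst (affine_map m p w s) \<alpha> x)" for \<alpha> x
      proof -
        have "fst (affine_map m p w s) \<alpha> x = fst p \<alpha> x + (\<Sum>i<m. s i * fst (w i) \<alpha> x)" for s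
          unfolding affine_map_def by (induction m) (simp_all add: scaleR_fun_def)
        then show ?thesis by (simp add: continuous_intros continuous_on_product_coordinates)
      qed
      have cV: "continuous_on UNIV (\<lambda>s. snd (affine_map m p w s) i x)" for i x
      proof -
        have "snd (affine_map m p w s) i x = snd p i x + (\<Sum>j<m. s j * snd (w j) i x)" for s
          unfolding affine_map_def by (induction m) (simp_all add: scaleR_fun_def)
        then show ?thesis by (simp add: continuous_intros continuous_on_product_coordinates)
      qed
      have "{s. affine_map m p w s \<in> U} =
          (\<Inter>\<alpha>\<in>F. \<Inter>x\<in>states N \<alpha>. {s. fst (affine_map m p w s) \<alpha> x > 0}) \<inter>
          (\<Inter>i\<in>V. \<Inter>x\<in>{1..N i}. {s. snd (affine_map m p w s) i x > 0})"
        by (auto simp: U_def)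
      also have "open \<dots>"
        using finF finV fin\<alpha> finite_states
        by (intro open_Int open_INT ballI open_Collect_less continuous_intros cF cV) auto
      finally show ?thesis .
    qed
    show "((\<lambda>\<tau>. multinomial_bethe V F N \<Psi> (q + \<tau> *\<^sub>R v)) has_real_derivative D q v) (at 0)"
      if q: "q \<in> U" for q v
    proof -
      have "multinomial_bethe V F N \<Psi> q' =
         - (\<Sum>\<alpha>\<in>F. \<Sum>x\<in>states N \<alpha>. fst q' \<alpha> x * ln (\<Psi> \<alpha> x))
         + (\<Sum>\<alpha>\<in>F. \<Sum>x\<in>states N \<alpha>. fst q' \<alpha> x * ln (fst q' \<alpha> x))
         + (\<Sum>i\<in>V. (1 - real (hdegree F i)) * (\<Sum>x = 1..N i. snd q' i x * ln (snd q' i x)))" for q'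
        by (simp add: multinomial_bethe_def split: prod.split)
      then show ?thesis
        unfolding D_def using q
        by (simp only: line)
           (intro DERIV_add DERIV_minus DERIV_sum DERIV_cmult entropy_has_derivative,
            auto simp: U_def intro!: derivative_eq_intros)
    qed
    show "((\<lambda>\<tau>. D (\<eta> + \<tau> *\<^sub>R w) v) has_real_derivative Q w v) (at 0)" for v w
    proof -
      have ln_deriv: "((\<lambda>\<tau>. c * ln (b + \<tau> * d) + c) has_real_derivative d * c / b) (at 0)"
        if "b > 0" for b c d :: real
        using that by (auto intro!: derivative_eq_intros)
      have "((\<lambda>\<tau>. D (\<eta> + \<tau> *\<^sub>R w) v) has_real_derivative 0 + 
         (\<Sum>\<alpha>\<in>F. \<Sum>x\<in>states N \<alpha>. fst w \<alpha> x * fst v \<alpha> x / bF \<alpha> x)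
         + (\<Sum>i\<in>V. (1 - real (hdegree F i)) * (\<Sum>x = 1..N i. snd w i x * snd v i x / bV i x))) (at 0)"
        unfolding D_def line
        by (intro DERIV_add DERIV_const DERIV_sum DERIV_cmult) (auto simp: \<eta>_eq intro!: ln_deriv bF bV(1))
      then show ?thesis by (simp add: Q_def)
    qed
    show "linear (Q w)" for w
      unfolding Q_def
      by (intro linearI)
         (simp_all add: scaleR_fun_def sum.distrib sum_distrib_left algebra_simps add_divide_distrib)
    show "Q v w = Q w v" for v w
      unfolding Q_def by (simp add: mult.commute)
    show "Q h h > 0" if hT: "h \<in> T" and h0: "h \<noteq> 0" for h
    proof -
      obtain hF hV where h: "h = (hF, hV)" by (cases h)
      have hF0: "(\<Sum>x\<in>states N \<alpha>. hF \<alpha> x) = 0" if "\<alpha> \<in> F" for \<alpha> using hT that by (simp add: T_def h)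
      have hV0: "(\<Sum>x = 1..N i. hV i x) = 0" if "i \<in> V" for i using hT that by (simp add: T_def h)
      have hmarg: "(\<Sum>x | x \<in> states N \<alpha> \<and> x i = y. hF \<alpha> x) = hV i y"
        if "\<alpha> \<in> F" "i \<in> \<alpha>" "y \<in> {1..N i}" for \<alpha> i y
        using hT that by (simp add: T_def h)
      have hF_out: "hF \<alpha> x = 0" if "\<not> (\<alpha> \<in> F \<and> x \<in> states N \<alpha>)" for \<alpha> x
        using hT that by (simp add: T_def h)
      have hV_out: "hV i x = 0" if "\<not> (i \<in> V \<and> x \<in> {1..N i})" for i x
        using hT that unfolding T_def h by blast
      have split_last: "(\<Sum>x = 1..N i. f x) = (\<Sum>x=1..r i. f x) + (f (N i) :: real)" if "i \<in> V" for f i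
        using N[OF that] unfolding r by (cases "N i") auto
      show ?thesis
      \<comment> \<open>If the free vertex coordinates vanish, so does the last one, as each
        \<open>hV i\<close> sums to zero. Only the factor terms remain, and
        \<open>h \<noteq> 0\<close> makes them positive. The vertex terms, with their possibly
        negative coefficients, matter only in the other case.\<close>
      proof (cases "\<exists>i\<in>V. \<exists>k\<in>{1..r i}. hV i k \<noteq> 0")
        case False
        have hV: "hV i x = 0" for i x
        proof (cases "i \<in> V \<and> x \<in> {1..N i}")
          case True
          then have "hV i (N i) = 0" using hV0[of i] split_last[of i "hV i"] False by simp
          moreover have "x = N i \<or> x \<in> {1..r i}" using True by (auto simp: r)
          ultimately show ?thesis using False True by auto
        qed (rule hV_out)
        have "\<exists>\<alpha> x. hF \<alpha> x \<noteq> 0"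
          using h0 hV by (auto simp: h fun_eq_iff zero_prod_def)
        then obtain \<alpha> x where \<alpha>x: "hF \<alpha> x \<noteq> 0" "\<alpha> \<in> F" "x \<in> states N \<alpha>" using hF_out by blast
        have nn: "hF \<beta> y * hF \<beta> y / bF \<beta> y \<ge> 0" if "\<beta> \<in> F" "y \<in> states N \<beta>" for \<beta> y
          using bF[OF that] by simp
        have "(\<Sum>x\<in>states N \<alpha>. hF \<alpha> x * hF \<alpha> x / bF \<alpha> x) > 0"
        proof (rule sum_pos2[of _ x])
          show "hF \<alpha> x * hF \<alpha> x / bF \<alpha> x > 0"
            using \<alpha>x(1) bF[OF \<alpha>x(2,3)] by (metis divide_pos_pos not_real_square_gt_zero)
        qed (use \<alpha>x nn finite_states[OF fin\<alpha>[OF \<alpha>x(2)]] in auto)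
        then have "(\<Sum>\<alpha>\<in>F. \<Sum>x\<in>states N \<alpha>. hF \<alpha> x * hF \<alpha> x / bF \<alpha> x) > 0"
          using \<alpha>x(2) nn by (intro sum_pos2[OF finF, of \<alpha>] sum_nonneg)
        then show ?thesis by (simp add: Q_def h hV)
      next
        case True
        then obtain i0 k0 where i0: "i0 \<in> V" "k0 \<in> {1..r i0}" "hV i0 k0 \<noteq> 0" by blast
        define Var where "Var = (\<lambda>j k l. cov (point_measure {1..N j} (\<lambda>x. ennreal (bV j x)))
                  (multinomial_phi k) (multinomial_phi l))"
        define C where "C = (\<lambda>\<alpha> j i k l. cov (point_measure (states N \<alpha>) (\<lambda>x. ennreal (bF \<alpha> x)))
                  (\<lambda>x. multinomial_phi k (x j)) (\<lambda>x. multinomial_phi l (x i)))"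
        define K where "K = (\<lambda>\<alpha> p q. C \<alpha> (fst p) (fst q) (snd p) (snd q))"
        define \<phi> where "\<phi> = (\<lambda>p x. multinomial_phi (snd p) (x (fst p :: 'v)))"
        define mV where "mV = (\<lambda>i k. \<Sum>x=1..N i. bV i x * multinomial_phi k x)"
        define m where "m = (\<lambda>\<alpha> p. \<Sum>x\<in>states N \<alpha>. bF \<alpha> x * \<phi> p x)"
        have Var_eq: "Var i k l = (\<Sum>x=1..N i. bV i x * ((multinomial_phi k x - mV i k) * (multinomial_phi l x - mV i l)))"
          if "i \<in> V" for i k l
          unfolding Var_def mV_def using bV(1)[OF that] by (intro cov_point_measure) (auto simp: less_imp_le)
        have K_eq: "K \<alpha> p q = (\<Sum>x\<in>states N \<alpha>. bF \<alpha> x * ((\<phi> p x - m \<alpha> p) * (\<phi> q x - m \<alpha> q)))"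
          if "\<alpha> \<in> F" for \<alpha> p q
          unfolding K_def C_def m_def \<phi>_def using bF[OF that] finite_states[OF fin\<alpha>[OF that]]
          by (intro cov_point_measure) (auto simp: less_imp_le)
        have mV: "mV i k = bV i k" if "k \<in> {1..r i}" for i k
        proof -
          have "mV i k = (\<Sum>x=1..N i. if x = k then bV i k else 0)"
            unfolding mV_def by (intro sum.cong refl) (simp add: multinomial_phi_def)
          then show ?thesis using that by (auto simp: r)
        qed
        \<comment> \<open>The inverse of the vertex covariance applied to \<open>hV i\<close>. On
          the states below \<open>N i\<close> that covariance is
          \<open>diag b - b b\<^sup>T\<close>; by Sherman-Morrison its inverse is
          \<open>diag (1/b)\<close> plus the constant matrix with entry
          \<open>1 / bV i (N i)\<close>, and the free coordinates of \<open>hV i\<close> sum to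
          \<open>- hV i (N i)\<close>.\<close>
        define g where "g = (\<lambda>i k. hV i k / bV i k - hV i (N i) / bV i (N i))"
        have u: "multinomial_u N \<eta> = edge_weights r Var C"
          by (simp add: multinomial_u_def \<eta>_eq r_def Var_def C_def)
        have NV: "N i \<in> {1..N i}" if "i \<in> V" for i using N[OF that] by simp
        have rN: "k \<in> {1..N i}" if "k \<in> {1..r i}" for i k using that by (auto simp: r)
        have "\<exists>a. (\<Sum>\<alpha>\<in>F. 2 * (\<Sum>i\<in>\<alpha>. \<Sum>k=1..r i. a \<alpha> (i, k) * hV i k)
                  - quad (SIGMA i:\<alpha>. {1..r i}) (K \<alpha>) (a \<alpha>) (a \<alpha>))
            + (\<Sum>i\<in>V. (1 - real (hdegree F i)) * (\<Sum>k=1..r i. g i k * hV i k)) > 0"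
        proof (rule reduced_bethe_form_pos[OF finV FV, where Var = Var and C = C])
          fix i assume i: "i \<in> V"
          show "pd_on {1..r i} (Var i)"
          proof (rule pd_on_covariance)
            show "bV i x > 0" if "x \<in> {1..N i}" for x using bV i that by blast
            show "Var i k l = (\<Sum>x=1..N i. bV i x * ((multinomial_phi k x - mV i k) * (multinomial_phi l x - mV i l)))" for k l
              by (rule Var_eq[OF i])
            fix a c p assume c: "\<And>x. x \<in> {1..N i} \<Longrightarrow> (\<Sum>k=1..r i. a k * multinomial_phi k x) = c"
              and p: "p \<in> {1..r i}"
            have "c = (\<Sum>k=1..r i. a k * multinomial_phi k (N i))" using c[OF NV[OF i]] by simp
            also have "\<dots> = 0" by (intro sum.neutral) (auto simp: multinomial_phi_def r)
            finally have "0 = (\<Sum>k=1..r i. a k * multinomial_phi k p)" using c[OF rN[OF p]] by simp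
            also have "\<dots> = (\<Sum>k=1..r i. if k = p then a p else 0)"
              by (intro sum.cong refl) (auto simp: multinomial_phi_def)
            finally show "a p = 0" using p by simp
          qed simp
          show "(\<Sum>l=1..r i. Var i k l * g i l) = hV i k" if k: "k \<in> {1..r i}" for k
          proof -
            have Var_kl: "Var i k l = (if k = l then bV i k else 0) - bV i k * bV i l" if l: "l \<in> {1..r i}" for l
            proof -
              have "Var i k l = (\<Sum>x=1..N i. (if x = k then (if k = l then bV i k else 0) else 0)
                  - mV i k * (bV i x * multinomial_phi l x) - mV i l * (bV i x * multinomial_phi k x)
                  + mV i k * mV i l * bV i x)"
                unfolding Var_eq[OF i]
                by (intro sum.cong refl) (auto simp: multinomial_phi_def algebra_simps)
              also have "\<dots> = (if k = l then bV i k else 0) - mV i k * mV i l - mV i l * mV i k + mV i k * mV i l"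
              proof -
                have "(\<Sum>x=1..N i. bV i x * multinomial_phi k' x) = mV i k'" for k' by (simp add: mV_def)
                then show ?thesis
                  using rN[OF k] bV(2)[OF i NV[OF i]]
                  by (simp add: sum.distrib sum_subtractf sum_distrib_left[symmetric] del: One_nat_def)
              qed
              finally show ?thesis using mV k l by simp
            qed
            have "(\<Sum>l=1..r i. bV i l * g i l) = (\<Sum>l=1..r i. hV i l - hV i (N i) / bV i (N i) * bV i l)"
              using bV(1)[OF i rN] by (intro sum.cong refl) (force simp: g_def field_simps)
            also have "\<dots> = - hV i (N i) - hV i (N i) / bV i (N i) * (1 - bV i (N i))"
            proof -
              have "(\<Sum>l=1..r i. hV i l) = - hV i (N i)" "(\<Sum>l=1..r i. bV i l) = 1 - bV i (N i)"
                using split_last[OF i, of "hV i"] split_last[OF i, of "bV i"] hV0[OF i] bV(2)[OF i NV[OF i]]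
                by simp_all
              then show ?thesis by (simp only: sum_subtractf sum_distrib_left[symmetric])
            qed
            also have "\<dots> = - hV i (N i) / bV i (N i)"
              using bV(1)[OF i NV[OF i]] by (simp add: field_simps)
            finally have s: "(\<Sum>l=1..r i. bV i l * g i l) = - hV i (N i) / bV i (N i)" .
            have "(\<Sum>l=1..r i. Var i k l * g i l)
                = (\<Sum>l=1..r i. (if l = k then bV i k * g i k else 0) - bV i k * (bV i l * g i l))"
              by (intro sum.cong refl) (auto simp: Var_kl left_diff_distrib mult.assoc)
            also have "\<dots> = bV i k * g i k - bV i k * (\<Sum>l=1..r i. bV i l * g i l)"
              using k by (simp add: sum_subtractf sum_distrib_left)
            also have "\<dots> = hV i k"
              unfolding s unfolding g_def using bV(1)[OF i rN[OF k]] bV(1)[OF i NV[OF i]] by (simp add: field_simps)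
            finally show ?thesis .
          qed
        next
          fix \<alpha> assume \<alpha>: "\<alpha> \<in> F"
          show "pd_on (SIGMA i:\<alpha>. {1..r i}) (K \<alpha>)"
          proof (rule pd_on_covariance[OF finite_states[OF fin\<alpha>[OF \<alpha>]] bF[OF \<alpha>] K_eq[OF \<alpha>]])
            fix a c p assume c: "\<And>x. x \<in> states N \<alpha> \<Longrightarrow> (\<Sum>p\<in>(SIGMA i:\<alpha>. {1..r i}). a p * \<phi> p x) = c"
              and p: "p \<in> (SIGMA i:\<alpha>. {1..r i})"
            show "a p = 0"
              by (rule multinomial_phi_independent[OF fin\<alpha>[OF \<alpha>] _ _ p[unfolded r], where c = c])
                 (use c N \<alpha>V[OF \<alpha>] in \<open>auto simp: \<phi>_def r\<close>)
          qed
          show "K \<alpha> (i, k) (i, l) = Var i k l" if i: "i \<in> \<alpha>" for i k l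
          proof -
            have iV: "i \<in> V" using \<alpha>V[OF \<alpha>] i by blast
            have marg: "(\<Sum>x\<in>states N \<alpha>. bF \<alpha> x * f (x i)) = (\<Sum>y=1..N i. bV i y * f y)" for f
              by (rule sum_states_marginal[OF fin\<alpha>[OF \<alpha>] i bmarg[OF \<alpha> i]])
            have mm: "m \<alpha> (i, k) = mV i k" for k
              unfolding m_def mV_def \<phi>_def using marg[of "multinomial_phi k"] by simp
            show ?thesis unfolding K_eq[OF \<alpha>] Var_eq[OF iV] mm
              using marg[of "\<lambda>y. (multinomial_phi k y - mV i k) * (multinomial_phi l y - mV i l)"]
              by (simp add: \<phi>_def)
          qed
          show "K \<alpha> (i, k) (j, l) = C \<alpha> i j k l" for i j k l by (simp add: K_def)
        next
          show "z \<notin> complex_of_real ` {1..}" if "edge_op_eigenvalue F r (edge_weights r Var C) z" for z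
            using eig that by (simp add: u r_def)
        qed (use i0 in auto)
        then obtain a where a: "(\<Sum>\<alpha>\<in>F. 2 * (\<Sum>i\<in>\<alpha>. \<Sum>k=1..r i. a \<alpha> (i, k) * hV i k)
                  - quad (SIGMA i:\<alpha>. {1..r i}) (K \<alpha>) (a \<alpha>) (a \<alpha>))
            + (\<Sum>i\<in>V. (1 - real (hdegree F i)) * (\<Sum>k=1..r i. g i k * hV i k)) > 0" by blast
        \<comment> \<open>Pointwise completion of the square
          \<open>(hF - bF G)\<^sup>2 / bF\<close>, where \<open>G\<close> is the centred statistic
          with coefficients \<open>a \<alpha>\<close>. Its weighted mean square is the form of
          \<open>K \<alpha>\<close>. Centring does not affect the pairing with \<open>hF\<close>,
          which has total mass zero, and the marginal constraints turn this pairing into one with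
          \<open>hV\<close>.\<close>
        have factor: "2 * (\<Sum>i\<in>\<alpha>. \<Sum>k=1..r i. a \<alpha> (i, k) * hV i k)
              - quad (SIGMA i:\<alpha>. {1..r i}) (K \<alpha>) (a \<alpha>) (a \<alpha>)
            \<le> (\<Sum>x\<in>states N \<alpha>. hF \<alpha> x * hF \<alpha> x / bF \<alpha> x)" if \<alpha>: "\<alpha> \<in> F" for \<alpha>
        proof -
          define J where "J = (SIGMA i:\<alpha>. {1..r i})"
          define G where "G = (\<lambda>x. \<Sum>p\<in>J. a \<alpha> p * (\<phi> p x - m \<alpha> p))"
          have quad_eq: "quad J (K \<alpha>) (a \<alpha>) (a \<alpha>) = (\<Sum>x\<in>states N \<alpha>. bF \<alpha> x * (G x)\<^sup>2)"
            unfolding G_def by (rule quad_covariance) (rule K_eq[OF \<alpha>])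
          have hphi: "(\<Sum>x\<in>states N \<alpha>. hF \<alpha> x * \<phi> (i, k) x) = hV i k"
            if i: "i \<in> \<alpha>" and k: "k \<in> {1..r i}" for i k
          proof -
            have "(\<Sum>x\<in>states N \<alpha>. hF \<alpha> x * \<phi> (i, k) x) = (\<Sum>y=1..N i. hV i y * multinomial_phi k y)"
              unfolding \<phi>_def fst_conv snd_conv
              by (rule sum_states_marginal[OF fin\<alpha>[OF \<alpha>] i hmarg[OF \<alpha> i]])
            also have "\<dots> = (\<Sum>y=1..N i. if y = k then hV i k else 0)"
              by (intro sum.cong refl) (simp add: multinomial_phi_def)
            finally show ?thesis using rN[OF k] by simp
          qed
          have "(\<Sum>x\<in>states N \<alpha>. hF \<alpha> x * G x)
              = (\<Sum>p\<in>J. a \<alpha> p * (\<Sum>x\<in>states N \<alpha>. hF \<alpha> x * (\<phi> p x - m \<alpha> p)))"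
            unfolding G_def sum_distrib_left by (subst sum.swap) (simp add: mult_ac)
          also have "\<dots> = (\<Sum>p\<in>J. a \<alpha> p * (\<Sum>x\<in>states N \<alpha>. hF \<alpha> x * \<phi> p x))"
            using hF0[OF \<alpha>] by (simp add: right_diff_distrib sum_subtractf sum_distrib_right[symmetric])
          also have "\<dots> = (\<Sum>i\<in>\<alpha>. \<Sum>k=1..r i. a \<alpha> (i, k) * hV i k)"
            unfolding J_def sum_indexed[OF fin\<alpha>[OF \<alpha>]] by (intro sum.cong refl) (simp add: hphi)
          finally have lin: "(\<Sum>x\<in>states N \<alpha>. hF \<alpha> x * G x) = (\<Sum>i\<in>\<alpha>. \<Sum>k=1..r i. a \<alpha> (i, k) * hV i k)" .
          have "2 * (\<Sum>x\<in>states N \<alpha>. hF \<alpha> x * G x) - (\<Sum>x\<in>states N \<alpha>. bF \<alpha> x * (G x)\<^sup>2)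
              = (\<Sum>x\<in>states N \<alpha>. 2 * (hF \<alpha> x * G x) - bF \<alpha> x * (G x)\<^sup>2)"
            by (simp add: sum_subtractf sum_distrib_left)
          also have "\<dots> \<le> (\<Sum>x\<in>states N \<alpha>. hF \<alpha> x * hF \<alpha> x / bF \<alpha> x)"
          proof (rule sum_mono)
            fix x assume "x \<in> states N \<alpha>"
            then have b: "bF \<alpha> x > 0" by (rule bF[OF \<alpha>])
            have "0 \<le> (hF \<alpha> x - bF \<alpha> x * G x)\<^sup>2 / bF \<alpha> x" using b by simp
            also have "\<dots> = hF \<alpha> x * hF \<alpha> x / bF \<alpha> x - (2 * (hF \<alpha> x * G x) - bF \<alpha> x * (G x)\<^sup>2)"
              using b by (simp add: field_simps power2_eq_square)
            finally show "2 * (hF \<alpha> x * G x) - bF \<alpha> x * (G x)\<^sup>2 \<le> hF \<alpha> x * hF \<alpha> x / bF \<alpha> x" by simp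
          qed
          finally show ?thesis unfolding lin quad_eq[symmetric] J_def .
        qed
        \<comment> \<open>The last state, missing from the coordinates, comes back through the
          correction term in \<open>g\<close>, again because \<open>hV i\<close> sums to
          zero.\<close>
        have vertex: "(\<Sum>k=1..r i. g i k * hV i k) = (\<Sum>x=1..N i. hV i x * hV i x / bV i x)" if i: "i \<in> V" for i
        proof -
          have "(\<Sum>k=1..r i. g i k * hV i k)
              = (\<Sum>k=1..r i. hV i k * hV i k / bV i k) - hV i (N i) / bV i (N i) * (\<Sum>k=1..r i. hV i k)"
            by (simp add: g_def left_diff_distrib sum_subtractf sum_distrib_left)
          also have "(\<Sum>k=1..r i. hV i k) = - hV i (N i)"
            using split_last[OF i, of "hV i"] hV0[OF i] by simp
          finally show ?thesis unfolding split_last[OF i] by simp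
        qed
        have "(\<Sum>\<alpha>\<in>F. 2 * (\<Sum>i\<in>\<alpha>. \<Sum>k=1..r i. a \<alpha> (i, k) * hV i k)
                  - quad (SIGMA i:\<alpha>. {1..r i}) (K \<alpha>) (a \<alpha>) (a \<alpha>))
            + (\<Sum>i\<in>V. (1 - real (hdegree F i)) * (\<Sum>k=1..r i. g i k * hV i k)) \<le> Q h h"
          unfolding Q_def h fst_conv snd_conv
          by (intro add_mono sum_mono factor) (simp_all only: vertex order_refl)
        then show ?thesis using a by linarith
      qed
    qed
  qed
qed

section \<open>Fixed-mean Gaussian families\<close>

text \<open>The second factor is the conditional law of the second coordinate: its mean is the
  regression line, its variance the Schur complement.\<close>

lemma normal2_density_factor:
  assumes v: "v > 0" and det: "v * w - c\<^sup>2 > 0"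
  shows "normal2_density a b v c w (x, y) =
    normal_density a (sqrt v) x * normal_density (b + c / v * (x - a)) (sqrt ((v * w - c\<^sup>2) / v)) y"
proof -
  define \<Delta> where "\<Delta> = v * w - c\<^sup>2"
  have \<Delta>: "\<Delta> > 0" using det by (simp add: \<Delta>_def)
  \<comment> \<open>Eliminating \<open>w\<close> in favour of the determinant turns the comparison
    of exponents into a rational identity with denominators \<open>v\<close> and \<Delta>.\<close>
  have w: "w = (\<Delta> + c\<^sup>2) / v" using v by (simp add: \<Delta>_def)
  have "sqrt (2 * pi * v) * sqrt (2 * pi * (\<Delta> / v)) = sqrt ((2 * pi)\<^sup>2 * \<Delta>)"
    using v by (simp add: real_sqrt_mult[symmetric] power2_eq_square)
  then have const: "sqrt (2 * pi * v) * sqrt (2 * pi * (\<Delta> / v)) = 2 * pi * sqrt \<Delta>"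
    by (simp add: real_sqrt_mult)
  have expo: "- (w * (x - a)\<^sup>2 - 2 * c * (x - a) * (y - b) + v * (y - b)\<^sup>2) / (2 * \<Delta>)
      = - (x - a)\<^sup>2 / (2 * v) + - (y - (b + c / v * (x - a)))\<^sup>2 / (2 * (\<Delta> / v))"
  proof -
    define X Y where "X = x - a" and "Y = y - b"
    have Y': "y - (b + c / v * (x - a)) = Y - c / v * X" by (simp add: X_def Y_def)
    have "- (w * X\<^sup>2 - 2 * c * X * Y + v * Y\<^sup>2) / (2 * \<Delta>)
      = - X\<^sup>2 / (2 * v) + - (Y - c / v * X)\<^sup>2 / (2 * (\<Delta> / v))"
      unfolding w using v \<Delta> by (simp add: field_simps power2_eq_square)
    then show ?thesis unfolding Y' by (simp only: X_def Y_def)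
  qed
  have "normal_density a (sqrt v) x * normal_density (b + c / v * (x - a)) (sqrt (\<Delta> / v)) y
     = 1 / (sqrt (2 * pi * v) * sqrt (2 * pi * (\<Delta> / v))) *
       exp (- (x - a)\<^sup>2 / (2 * v) + - (y - (b + c / v * (x - a)))\<^sup>2 / (2 * (\<Delta> / v)))"
    unfolding exp_add using v \<Delta> by (simp add: normal_density_def)
  then show ?thesis
    unfolding const expo[symmetric] normal2_density_def \<Delta>_def[symmetric] by simp
qed

lemma borel_measurable_coordinates [measurable]:
  "(fst :: real \<times> real \<Rightarrow> real) \<in> borel_measurable borel"
  "(snd :: real \<times> real \<Rightarrow> real) \<in> borel_measurable borel"
  by (intro borel_measurable_continuous_onI continuous_intros)+

lemma borel_measurable_normal2_density [measurable]:
  "normal2_density a b v c w \<in> borel_measurable borel"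
  unfolding normal2_density_def case_prod_beta by measurable

text \<open>Integrates over the conditional law and afterwards over the first marginal. For a
  nonnegative integrand Tonelli delivers integrability together with the value.\<close>

lemma has_bochner_integral_normal2:
  assumes v: "v > 0" and det: "v * w - c\<^sup>2 > 0"
    and f: "f \<in> borel_measurable (borel :: (real \<times> real) measure)" "\<And>z. f z \<ge> 0" and g: "\<And>x. g x \<ge> 0" and I: "I \<ge> 0"
    and inner: "\<And>x. has_bochner_integral lborel
      (\<lambda>y. normal_density (b + c / v * (x - a)) (sqrt ((v * w - c\<^sup>2) / v)) y * f (x, y)) (g x)"
    and outer: "has_bochner_integral lborel (\<lambda>x. normal_density a (sqrt v) x * g x) I"
  shows "has_bochner_integral lborel (\<lambda>z. normal2_density a b v c w z * f z) I"
proof (rule has_bochner_integral_nn_integral)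
  have [measurable]: "f \<in> borel_measurable borel" by (rule f)
  show "(\<lambda>z. normal2_density a b v c w z * f z) \<in> borel_measurable lborel" by measurable
  have nn: "normal2_density a b v c w z \<ge> 0" for z
    using det by (cases z) (simp add: normal2_density_def)
  then show "AE z in lborel. 0 \<le> normal2_density a b v c w z * f z" using f by simp
  show "0 \<le> I" by (rule I)
  have meas: "(\<lambda>z. ennreal (normal2_density a b v c w z * f z)) \<in> borel_measurable (lborel \<Otimes>\<^sub>M lborel)"
    unfolding lborel_prod by measurable
  have "(\<integral>\<^sup>+z. ennreal (normal2_density a b v c w z * f z) \<partial>lborel)
      = (\<integral>\<^sup>+x. \<integral>\<^sup>+y. ennreal (normal2_density a b v c w (x, y) * f (x, y)) \<partial>lborel \<partial>lborel)"
    using lborel.nn_integral_fst[OF meas] by (simp add: lborel_prod)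
  also have "\<dots> = (\<integral>\<^sup>+x. ennreal (normal_density a (sqrt v) x * g x) \<partial>lborel)"
  proof (rule nn_integral_cong)
    fix x
    have h: "has_bochner_integral lborel (\<lambda>y. normal2_density a b v c w (x, y) * f (x, y))
        (normal_density a (sqrt v) x * g x)"
      using has_bochner_integral_mult_right[OF inner[of x], of "normal_density a (sqrt v) x"]
      by (simp add: normal2_density_factor[OF v det] mult.assoc)
    show "(\<integral>\<^sup>+y. ennreal (normal2_density a b v c w (x, y) * f (x, y)) \<partial>lborel)
        = ennreal (normal_density a (sqrt v) x * g x)"
      using h nn f(2) by (subst nn_integral_eq_integral) (auto simp: has_bochner_integral_iff)
  qed
  also have "\<dots> = ennreal I"
    using outer g by (subst nn_integral_eq_integral) (auto simp: has_bochner_integral_iff)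
  finally show "(\<integral>\<^sup>+z. ennreal (normal2_density a b v c w z * f z) \<partial>lborel) = ennreal I" .
qed

lemma normal_second_moment:
  assumes "v > 0"
  shows "has_bochner_integral lborel (\<lambda>x. normal_density a (sqrt v) x * (x - a)\<^sup>2) v"
  using normal_moment_even[of "sqrt v" a 1] assms by simp

lemma normal_fourth_moment:
  assumes "v > 0"
  shows "has_bochner_integral lborel (\<lambda>x. normal_density a (sqrt v) x * (x - a) ^ 4) (3 * v\<^sup>2)"
  using normal_moment_even[of "sqrt v" a 2] assms
  by (simp add: fact_numeral power_divide)

text \<open>Variance plus squared bias. It serves the conditional law, whose mean moves with the
  other coordinate while the squares are centred at the fixed mean.\<close>

lemma normal_second_moment_about:
  assumes v: "v > 0"
  shows "has_bochner_integral lborel (\<lambda>x. normal_density a (sqrt v) x * (x - d)\<^sup>2) (v + (a - d)\<^sup>2)"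
proof -
  have s: "sqrt v > 0" using v by simp
  have "has_bochner_integral lborel (\<lambda>x. normal_density a (sqrt v) x * (x - a)) 0"
    using normal_moment_odd[OF s, of a 0] by simp
  from has_bochner_integral_mult_left[OF this, of "2 * (a - d)"]
  have 1: "has_bochner_integral lborel (\<lambda>x. normal_density a (sqrt v) x * (x - a) * (2 * (a - d))) 0"
    by simp
  have "has_bochner_integral lborel (\<lambda>x. normal_density a (sqrt v) x) 1"
    using normal_moment_even[OF s, of a 0] by simp
  from has_bochner_integral_mult_left[OF this, of "(a - d)\<^sup>2"]
  have 2: "has_bochner_integral lborel (\<lambda>x. normal_density a (sqrt v) x * (a - d)\<^sup>2) ((a - d)\<^sup>2)"
    by simp
  have "has_bochner_integral lborel
     (\<lambda>x. normal_density a (sqrt v) x * (x - a)\<^sup>2 + normal_density a (sqrt v) x * (x - a) * (2 * (a - d))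
        + normal_density a (sqrt v) x * (a - d)\<^sup>2) (v + 0 + (a - d)\<^sup>2)"
    by (intro has_bochner_integral_add normal_second_moment v 1 2)
  moreover have "normal_density a (sqrt v) x * (x - a)\<^sup>2 + normal_density a (sqrt v) x * (x - a) * (2 * (a - d))
        + normal_density a (sqrt v) x * (a - d)\<^sup>2 = normal_density a (sqrt v) x * (x - d)\<^sup>2" for x
    by algebra
  ultimately show ?thesis by simp
qed

lemma cov_normal_squares:
  assumes v: "v > 0"
  shows "cov (normal_measure a v) (\<lambda>x. (x - a)\<^sup>2) (\<lambda>x. (x - a)\<^sup>2) = 2 * v\<^sup>2"
proof -
  have s: "sqrt v > 0" using v by simp
  have E: "(LINT x|normal_measure a v. f x) = (LINT x|lborel. normal_density a (sqrt v) x * f x)"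
    if "f \<in> borel_measurable borel" for f
    unfolding normal_measure_def using that by (subst integral_real_density) (auto simp: normal_density_nonneg)
  have m2: "(LINT x|normal_measure a v. (x - a)\<^sup>2) = v"
    using has_bochner_integral_integral_eq[OF normal_second_moment[OF v, of a]] by (subst E) auto
  have 1: "has_bochner_integral lborel (\<lambda>x. normal_density a (sqrt v) x * v\<^sup>2) (v\<^sup>2)"
    using has_bochner_integral_mult_left[OF normal_moment_even[OF s, of a 0], of "v\<^sup>2"] by simp
  have "has_bochner_integral lborel (\<lambda>x. normal_density a (sqrt v) x * (x - a) ^ 4
       - (normal_density a (sqrt v) x * (x - a)\<^sup>2) * (2 * v) + normal_density a (sqrt v) x * v\<^sup>2)
     (3 * v\<^sup>2 - v * (2 * v) + v\<^sup>2)"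
    by (intro has_bochner_integral_add has_bochner_integral_diff has_bochner_integral_mult_left
        normal_second_moment normal_fourth_moment v 1)
  moreover have "normal_density a (sqrt v) x * (x - a) ^ 4
       - (normal_density a (sqrt v) x * (x - a)\<^sup>2) * (2 * v) + normal_density a (sqrt v) x * v\<^sup>2
       = normal_density a (sqrt v) x * (((x - a)\<^sup>2 - v) * ((x - a)\<^sup>2 - v))" for x
    by algebra
  ultimately have "has_bochner_integral lborel
      (\<lambda>x. normal_density a (sqrt v) x * (((x - a)\<^sup>2 - v) * ((x - a)\<^sup>2 - v))) (2 * v\<^sup>2)"
    by (simp add: power2_eq_square)
  from has_bochner_integral_integral_eq[OF this] show ?thesis
    unfolding cov_def m2 by (subst E) auto
qed

text \<open>The Isserlis identity \<open>E X\<^sup>2 Y\<^sup>2 = v w + 2 c\<^sup>2\<close> for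
  centred \<open>X\<close>, \<open>Y\<close>, reached by conditioning: given \<open>X\<close>, the
  mean of \<open>Y\<^sup>2\<close> is \<open>\<Delta> / v + (c / v)\<^sup>2 X\<^sup>2\<close>, and
  \<open>X\<close> has second moment \<open>v\<close> and fourth moment
  \<open>3 v\<^sup>2\<close>.\<close>

lemma cov_normal2_squares:
  assumes v: "v > 0" and det: "v * w - c\<^sup>2 > 0"
  shows "cov (normal2_measure a b v c w) (\<lambda>(x, y). (x - a)\<^sup>2) (\<lambda>(x, y). (y - b)\<^sup>2) = 2 * c\<^sup>2"
proof -
  define \<Delta> where "\<Delta> = v * w - c\<^sup>2"
  have \<Delta>: "\<Delta> / v > 0" using v det by (simp add: \<Delta>_def)
  have w: "w > 0" using v det by (smt (verit) mult_le_0_iff zero_le_power2)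
  have s: "sqrt v > 0" "sqrt (\<Delta> / v) > 0" using v \<Delta> by auto
  let ?n = "normal2_density a b v c w"
  have nn: "?n z \<ge> 0" for z using det by (cases z) (simp add: normal2_density_def)
  have E: "(LINT z|normal2_measure a b v c w. f z) = (LINT z|lborel. ?n z * f z)"
    if "f \<in> borel_measurable borel" for f
    unfolding normal2_measure_def using that by (subst integral_real_density) (auto simp: nn)
  have one: "has_bochner_integral lborel (\<lambda>y. normal_density d (sqrt u) y * t) t" if "u > 0" for d u t
    using has_bochner_integral_mult_left[OF normal_moment_even[of "sqrt u" d 0], of t] that by simp
  have Ixx: "has_bochner_integral lborel (\<lambda>z. ?n z * (fst z - a)\<^sup>2) v"
    by (rule has_bochner_integral_normal2[OF v det, where g = "\<lambda>x. (x - a)\<^sup>2"])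
      (use v one[OF \<Delta>] normal_second_moment[OF v] in \<open>auto simp: \<Delta>_def\<close>)
  have inner: "has_bochner_integral lborel
      (\<lambda>y. normal_density (b + c / v * (x - a)) (sqrt (\<Delta> / v)) y * (y - b)\<^sup>2) (\<Delta> / v + (c / v)\<^sup>2 * (x - a)\<^sup>2)" for x
    using normal_second_moment_about[OF \<Delta>, of "b + c / v * (x - a)" b]
    by (simp add: power_mult_distrib power_divide)
  have Iyy: "has_bochner_integral lborel (\<lambda>z. ?n z * (snd z - b)\<^sup>2) w"
  proof (rule has_bochner_integral_normal2[OF v det, where g = "\<lambda>x. \<Delta> / v + (c / v)\<^sup>2 * (x - a)\<^sup>2"])
    have "has_bochner_integral lborel (\<lambda>x. normal_density a (sqrt v) x * (\<Delta> / v)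
        + (normal_density a (sqrt v) x * (x - a)\<^sup>2) * (c / v)\<^sup>2) (\<Delta> / v + v * (c / v)\<^sup>2)"
      by (intro has_bochner_integral_add has_bochner_integral_mult_left one normal_second_moment v)
    moreover have "\<Delta> / v + v * (c / v)\<^sup>2 = w" using v by (simp add: \<Delta>_def field_simps power2_eq_square)
    ultimately show "has_bochner_integral lborel
        (\<lambda>x. normal_density a (sqrt v) x * (\<Delta> / v + (c / v)\<^sup>2 * (x - a)\<^sup>2)) w"
      by (simp add: algebra_simps)
  qed (use w \<Delta> inner in \<open>auto simp: \<Delta>_def intro!: add_nonneg_nonneg\<close>)
  have Ixy: "has_bochner_integral lborel (\<lambda>z. ?n z * ((fst z - a)\<^sup>2 * (snd z - b)\<^sup>2)) (v * w + 2 * c\<^sup>2)"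
  proof (rule has_bochner_integral_normal2[OF v det,
        where g = "\<lambda>x. (x - a)\<^sup>2 * (\<Delta> / v + (c / v)\<^sup>2 * (x - a)\<^sup>2)"])
    have "has_bochner_integral lborel (\<lambda>x. (normal_density a (sqrt v) x * (x - a)\<^sup>2) * (\<Delta> / v)
        + (normal_density a (sqrt v) x * (x - a) ^ 4) * (c / v)\<^sup>2) (v * (\<Delta> / v) + 3 * v\<^sup>2 * (c / v)\<^sup>2)"
      by (intro has_bochner_integral_add has_bochner_integral_mult_left normal_second_moment
          normal_fourth_moment v)
    moreover have "v * (\<Delta> / v) + 3 * v\<^sup>2 * (c / v)\<^sup>2 = v * w + 2 * c\<^sup>2"
      using v by (simp add: \<Delta>_def field_simps power2_eq_square)
    moreover have "normal_density a (sqrt v) x * (x - a)\<^sup>2 * (\<Delta> / v)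
        + normal_density a (sqrt v) x * (x - a) ^ 4 * (c / v)\<^sup>2
        = normal_density a (sqrt v) x * ((x - a)\<^sup>2 * (\<Delta> / v + (c / v)\<^sup>2 * (x - a)\<^sup>2))" for x
      by algebra
    ultimately show "has_bochner_integral lborel
        (\<lambda>x. normal_density a (sqrt v) x * ((x - a)\<^sup>2 * (\<Delta> / v + (c / v)\<^sup>2 * (x - a)\<^sup>2))) (v * w + 2 * c\<^sup>2)"
      by simp
    show "has_bochner_integral lborel
        (\<lambda>y. normal_density (b + c / v * (x - a)) (sqrt ((v * w - c\<^sup>2) / v)) y
           * ((fst (x, y) - a)\<^sup>2 * (snd (x, y) - b)\<^sup>2))
        ((x - a)\<^sup>2 * (\<Delta> / v + (c / v)\<^sup>2 * (x - a)\<^sup>2))" for x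
      using has_bochner_integral_mult_right[OF inner[of x], of "(x - a)\<^sup>2"]
      by (simp add: \<Delta>_def mult_ac)
  qed (use v w \<Delta> in \<open>auto intro!: add_nonneg_nonneg mult_nonneg_nonneg\<close>)
  have I1: "has_bochner_integral lborel (\<lambda>z. ?n z * (v * w)) (v * w)"
    by (rule has_bochner_integral_normal2[OF v det, where g = "\<lambda>x. v * w"])
      (use v w one[OF \<Delta>] one[OF v] in \<open>auto simp: \<Delta>_def\<close>)
  \<comment> \<open>The product of centred squares changes sign, whereas the iterated integration
    handles nonnegative integrands; hence the expansion into four pieces integrated
    separately.\<close>
  have "has_bochner_integral lborel (\<lambda>z. ?n z * ((fst z - a)\<^sup>2 * (snd z - b)\<^sup>2)
      - (?n z * (fst z - a)\<^sup>2) * w - (?n z * (snd z - b)\<^sup>2) * v + ?n z * (v * w))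
      (v * w + 2 * c\<^sup>2 - v * w - w * v + v * w)"
    by (intro has_bochner_integral_add has_bochner_integral_diff has_bochner_integral_mult_left
        Ixx Iyy Ixy I1)
  moreover have "?n z * ((fst z - a)\<^sup>2 * (snd z - b)\<^sup>2)
      - (?n z * (fst z - a)\<^sup>2) * w - (?n z * (snd z - b)\<^sup>2) * v + ?n z * (v * w)
      = ?n z * (((fst z - a)\<^sup>2 - v) * ((snd z - b)\<^sup>2 - w))" for z
    by algebra
  ultimately have I: "has_bochner_integral lborel
      (\<lambda>z. ?n z * (((fst z - a)\<^sup>2 - v) * ((snd z - b)\<^sup>2 - w))) (2 * c\<^sup>2)"
    by simp
  have m: "(LINT z|normal2_measure a b v c w. (fst z - a)\<^sup>2) = v"
    "(LINT z|normal2_measure a b v c w. (snd z - b)\<^sup>2) = w"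
    using has_bochner_integral_integral_eq[OF Ixx] has_bochner_integral_integral_eq[OF Iyy]
    by (simp_all add: E)
  show ?thesis
    using has_bochner_integral_integral_eq[OF I]
    unfolding cov_def case_prod_beta m by (simp add: E)
qed

section \<open>Curvature of the logarithm of an edge determinant\<close>

text \<open>Divided by \<open>2 (a b - e\<^sup>2)\<^sup>2\<close>, this is the Hessian of \<open>- ln (a b - e\<^sup>2) / 2\<close> at \<open>(a, b, e)\<close>
  in the direction \<open>(h, k, l)\<close>.\<close>

definition edge_form :: "real \<Rightarrow> real \<Rightarrow> real \<Rightarrow> real \<Rightarrow> real \<Rightarrow> real \<Rightarrow> real" where
  "edge_form a b e h k l = (a * k + b * h - 2 * e * l)\<^sup>2 - 2 * (a * b - e\<^sup>2) * (h * k - l\<^sup>2)"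

text \<open>For the covariance matrix \<open>S\<close> of the edge and the symmetric direction
  \<open>H\<close>, the form is \<open>(det S)\<^sup>2\<close> times the trace of the square of
  \<open>S\<inverse> H\<close>. With a Cholesky factor \<open>L\<close> of \<open>S\<close> this
  trace is the squared Frobenius norm of \<open>L\<inverse> H (L\<inverse>)\<^sup>T\<close>; the
  three terms, cleared of the denominator \<open>a\<^sup>2\<close>, are its diagonal and
  off-diagonal entries.\<close>

lemma edge_form_nonneg:
  assumes a: "a > 0" and det: "a * b - e\<^sup>2 > 0"
  shows "edge_form a b e h k l \<ge> 0"
proof -
  have "a\<^sup>2 * edge_form a b e h k l = (h * (a * b - e\<^sup>2))\<^sup>2 + 2 * (a * b - e\<^sup>2) * (a * l - e * h)\<^sup>2
      + (a\<^sup>2 * k - 2 * a * e * l + e\<^sup>2 * h)\<^sup>2"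
    unfolding edge_form_def by algebra
  also have "\<dots> \<ge> 0" using det by simp
  finally show ?thesis using a by (simp add: zero_le_mult_iff)
qed

text \<open>Completion of the square: with \<open>X = diag (x, y)\<close>, the shifted direction is
  \<open>H - 2 S X S\<close>. The subtracted quadratic in \<open>x\<close> and \<open>y\<close> is
  the form of the covariance matrix of the two squares, so this is the Legendre dual bound for one
  edge.\<close>

lemma edge_form_lower_bound:
  assumes a: "a > 0" and det: "a * b - e\<^sup>2 > 0"
  shows "2 * (x * h + y * k) - (2 * a\<^sup>2 * x\<^sup>2 + 4 * e\<^sup>2 * x * y + 2 * b\<^sup>2 * y\<^sup>2)
           \<le> edge_form a b e h k l / (2 * (a * b - e\<^sup>2)\<^sup>2)"
proof -
  have "edge_form a b e (h - 2 * (a\<^sup>2 * x + e\<^sup>2 * y)) (k - 2 * (e\<^sup>2 * x + b\<^sup>2 * y)) (l - 2 * e * (a * x + b * y))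
     = edge_form a b e h k l
       - 2 * (a * b - e\<^sup>2)\<^sup>2 * (2 * (x * h + y * k) - (2 * a\<^sup>2 * x\<^sup>2 + 4 * e\<^sup>2 * x * y + 2 * b\<^sup>2 * y\<^sup>2))"
    unfolding edge_form_def by algebra
  then have "2 * (a * b - e\<^sup>2)\<^sup>2 * (2 * (x * h + y * k) - (2 * a\<^sup>2 * x\<^sup>2 + 4 * e\<^sup>2 * x * y + 2 * b\<^sup>2 * y\<^sup>2))
      \<le> edge_form a b e h k l"
    using edge_form_nonneg[OF assms] by (metis diff_ge_0_iff_ge)
  then show ?thesis using det by (simp add: pos_le_divide_eq mult.commute)
qed

lemma edge_form_pos:
  assumes "a * b - e\<^sup>2 > 0" "l \<noteq> 0"
  shows "edge_form a b e 0 0 l > 0"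
  using assms by (simp add: edge_form_def power_mult_distrib add_nonneg_pos)

text \<open>With the squared correlation \<open>q = e\<^sup>2 / (a b)\<close>, which is below 1,
  half the form is \<open>(1 - q) ((a x)\<^sup>2 + (b y)\<^sup>2) + q (a x + b y)\<^sup>2\<close>.
  The proof multiplies this by \<open>2 a b\<close>.\<close>

lemma gaussian_edge_pd:
  assumes a: "a > 0" and b: "b > 0" and det: "a * b - e\<^sup>2 > 0" and nz: "x \<noteq> 0 \<or> y \<noteq> 0"
  shows "2 * a\<^sup>2 * x\<^sup>2 + 4 * e\<^sup>2 * x * y + 2 * b\<^sup>2 * y\<^sup>2 > (0 :: real)"
proof -
  have "2 * a * b * (a\<^sup>2 * x\<^sup>2 + b\<^sup>2 * y\<^sup>2 + 2 * e\<^sup>2 * x * y)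
      = 2 * ((a * b - e\<^sup>2) * ((a * x)\<^sup>2 + (b * y)\<^sup>2) + e\<^sup>2 * (a * x + b * y)\<^sup>2)"
    by algebra
  also have "\<dots> > 0"
  proof -
    have "(a * x)\<^sup>2 + (b * y)\<^sup>2 > 0" using nz a b by (simp add: sum_power2_gt_zero_iff)
    then show ?thesis using det by (simp add: add_pos_nonneg)
  qed
  finally have "0 < 2 * a * b * (a\<^sup>2 * x\<^sup>2 + b\<^sup>2 * y\<^sup>2 + 2 * e\<^sup>2 * x * y)" .
  moreover have "2 * a * b > 0" using a b by simp
  ultimately have "0 < a\<^sup>2 * x\<^sup>2 + b\<^sup>2 * y\<^sup>2 + 2 * e\<^sup>2 * x * y" by (simp add: zero_less_mult_iff)
  then show ?thesis by simp
qed

section \<open>The Hessian of the Gaussian Bethe free energy\<close>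

lemma gaussian_hessian_positive_definite:
  fixes V :: "'v set" and \<eta> :: "'v gaussian_point"
  assumes G: "simple_graph V E" and lin: "linear \<l>" and \<eta>: "\<eta> \<in> gaussian_L V E"
    and eig: "\<And>z. edge_op_eigenvalue E gaussian_dim (gaussian_u \<mu> \<eta>) z \<Longrightarrow>
             z \<notin> complex_of_real ` {1..}"
  shows "hessian_positive_definite (gaussian_L V E) (gaussian_bethe V E \<l> c) \<eta>"
proof -
  obtain vr cv where \<eta>_eq: "\<eta> = (vr, cv)" by (cases \<eta>)
  have finV: "finite V" and EV: "E \<subseteq> Pow V" and card2: "\<And>\<alpha>. \<alpha> \<in> E \<Longrightarrow> card \<alpha> = 2"
    using G by (auto simp: simple_graph_def)
  have finE: "finite E" using finV EV by (rule rev_finite_subset[OF finite_Pow_iff[THEN iffD2]])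
  have "\<forall>\<alpha>\<in>E. \<exists>ij. \<alpha> = {fst ij, snd ij} \<and> fst ij \<noteq> snd ij"
    using card2 by (auto simp: card_2_iff)
  then obtain ends where ends: "\<And>\<alpha>. \<alpha> \<in> E \<Longrightarrow> \<alpha> = {fst (ends \<alpha>), snd (ends \<alpha>)} \<and> fst (ends \<alpha>) \<noteq> snd (ends \<alpha>)"
    by metis
  \<comment> \<open>An arbitrary order on the ends of each edge; \<open>edge_det\<close> is
    symmetric in them.\<close>
  define e1 e2 where "e1 = (\<lambda>\<alpha>. fst (ends \<alpha>))" and "e2 = (\<lambda>\<alpha>. snd (ends \<alpha>))"
  have e12: "\<alpha> = {e1 \<alpha>, e2 \<alpha>}" "e1 \<alpha> \<noteq> e2 \<alpha>" if "\<alpha> \<in> E" for \<alpha>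
    using ends[OF that] by (auto simp: e1_def e2_def)
  have sum_edge: "(\<Sum>i\<in>\<alpha>. f i) = f (e1 \<alpha>) + f (e2 \<alpha>)" if "\<alpha> \<in> E" for \<alpha> and f :: "'v \<Rightarrow> real"
    using e12[OF that] by (metis sum.empty sum.insert finite.intros empty_iff insert_iff add.right_neutral)
  have eV: "e1 \<alpha> \<in> V" "e2 \<alpha> \<in> V" if "\<alpha> \<in> E" for \<alpha>
    using e12(1)[OF that] EV that by (metis PowD insertI1 insertI2 subset_iff)+
  have det_eq: "edge_det q \<alpha> = fst q (e1 \<alpha>) * fst q (e2 \<alpha>) - (snd q \<alpha>)\<^sup>2" if "\<alpha> \<in> E" for q \<alpha>
  proof -
    have "(\<Prod>i\<in>\<alpha>. fst q i) = fst q (e1 \<alpha>) * fst q (e2 \<alpha>)"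
      using e12[OF that] by (metis prod.empty prod.insert finite.intros empty_iff insert_iff mult.right_neutral)
    then show ?thesis by (cases q) (simp add: edge_det_def)
  qed
  have vr: "vr i > 0" if "i \<in> V" for i using \<eta> that by (simp add: \<eta>_eq gaussian_L_def)
  have det: "vr (e1 \<alpha>) * vr (e2 \<alpha>) - (cv \<alpha>)\<^sup>2 > 0" if "\<alpha> \<in> E" for \<alpha>
    using \<eta> that det_eq[OF that, of \<eta>] unfolding \<eta>_eq gaussian_L_def by fastforce
  \<comment> \<open>The conditions cutting out \<open>gaussian_L\<close> are open apart from the
    normalising zeros, so only these restrict the directions.\<close>
  define T where "T = {h :: 'v gaussian_point. (\<forall>i. i \<notin> V \<longrightarrow> fst h i = 0) \<and> (\<forall>\<alpha>. \<alpha> \<notin> E \<longrightarrow> snd h \<alpha> = 0)}"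
  define U where "U = {q :: 'v gaussian_point. (\<forall>i\<in>V. fst q i > 0) \<and> (\<forall>\<alpha>\<in>E. edge_det q \<alpha> > 0)}"
  \<comment> \<open>The polar form of the quadratic function \<open>edge_det\<close>. Being bilinear
    and symmetric, it supplies the first derivative of \<open>edge_det\<close>, and
    \<open>dd w v\<close> is in turn the derivative of \<open>dd q v\<close> when \<open>q\<close>
    moves along \<open>w\<close>.\<close>
  define dd where "dd = (\<lambda>q v :: 'v gaussian_point. \<lambda>\<alpha>.
     fst q (e1 \<alpha>) * fst v (e2 \<alpha>) + fst q (e2 \<alpha>) * fst v (e1 \<alpha>) - 2 * snd q \<alpha> * snd v \<alpha>)"
  define D where "D = (\<lambda>q v :: 'v gaussian_point.
     \<l> v - (1/2) * (\<Sum>\<alpha>\<in>E. dd q v \<alpha> / edge_det q \<alpha>)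
     - (1/2) * (\<Sum>i\<in>V. (1 - real (hdegree E i)) * (fst v i / fst q i)))"
  define Q where "Q = (\<lambda>w v :: 'v gaussian_point.
     - (1/2) * (\<Sum>\<alpha>\<in>E. dd w v \<alpha> / edge_det \<eta> \<alpha> - dd \<eta> w \<alpha> * dd \<eta> v \<alpha> / (edge_det \<eta> \<alpha>)\<^sup>2)
     - (1/2) * (\<Sum>i\<in>V. (1 - real (hdegree E i)) * (- fst w i * fst v i / (vr i)\<^sup>2)))"
  have line: "fst (q + \<tau> *\<^sub>R v) i = fst q i + \<tau> * fst v i"
    "snd (q + \<tau> *\<^sub>R v) \<alpha> = snd q \<alpha> + \<tau> * snd v \<alpha>"
    for q v :: "'v gaussian_point" and \<tau> \<alpha> i
    by (simp_all add: scaleR_fun_def)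
  have det_deriv: "((\<lambda>\<tau>. edge_det (q + \<tau> *\<^sub>R v) \<alpha>) has_real_derivative dd q v \<alpha>) (at 0)"
    if "\<alpha> \<in> E" for q v \<alpha>
    unfolding det_eq[OF that] line dd_def
    by (auto intro!: derivative_eq_intros simp: algebra_simps)
  show ?thesis
  proof (rule hessian_positive_definiteI[where T = T and U = U and D = D and Q = Q])
    show "subspace T"
      unfolding subspace_def T_def by (auto simp: scaleR_fun_def)
    show "q - \<eta> \<in> T" if "q \<in> gaussian_L V E" for q
      using that \<eta> unfolding T_def gaussian_L_def by auto
    show "\<eta> \<in> U" using \<eta> unfolding U_def gaussian_L_def by auto
    show "open {s. affine_map m p w s \<in> U}" for m p w
    proof -
      have cV: "continuous_on UNIV (\<lambda>s. fst (affine_map m p w s) i)" for i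
      proof -
        have "fst (affine_map m p w s) i = fst p i + (\<Sum>j<m. s j * fst (w j) i)" for s
          unfolding affine_map_def by (induction m) (simp_all add: scaleR_fun_def)
        then show ?thesis by (simp add: continuous_intros continuous_on_product_coordinates)
      qed
      have cE: "continuous_on UNIV (\<lambda>s. snd (affine_map m p w s) \<alpha>)" for \<alpha>
      proof -
        have "snd (affine_map m p w s) \<alpha> = snd p \<alpha> + (\<Sum>j<m. s j * snd (w j) \<alpha>)" for s
          unfolding affine_map_def by (induction m) (simp_all add: scaleR_fun_def)
        then show ?thesis by (simp add: continuous_intros continuous_on_product_coordinates)
      qed
      have "{s. affine_map m p w s \<in> U} =
          (\<Inter>i\<in>V. {s. fst (affine_map m p w s) i > 0}) \<inter>
          (\<Inter>\<alpha>\<in>E. {s. fst (affine_map m p w s) (e1 \<alpha>) * fst (affine_map m p w s) (e2 \<alpha>)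
                      - (snd (affine_map m p w s) \<alpha>)\<^sup>2 > 0})"
        by (auto simp: U_def det_eq)
      also have "open \<dots>"
        using finV finE
        by (intro open_Int open_INT ballI open_Collect_less continuous_intros cE cV)
      finally show ?thesis .
    qed
    show "((\<lambda>\<tau>. gaussian_bethe V E \<l> c (q + \<tau> *\<^sub>R v)) has_real_derivative D q v) (at 0)"
      if q: "q \<in> U" for q v
    proof -
      have l: "((\<lambda>\<tau>. \<l> (q + \<tau> *\<^sub>R v)) has_real_derivative \<l> v) (at 0)"
        unfolding linear_add[OF lin] linear_scale[OF lin] by (auto intro!: derivative_eq_intros)
      have d: "((\<lambda>\<tau>. ln (edge_det (q + \<tau> *\<^sub>R v) \<alpha>)) has_real_derivative dd q v \<alpha> / edge_det q \<alpha>) (at 0)"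
        if "\<alpha> \<in> E" for \<alpha>
        using q that by (auto intro!: derivative_eq_intros det_deriv simp: U_def)
      have e: "((\<lambda>\<tau>. ln (fst (q + \<tau> *\<^sub>R v) i)) has_real_derivative fst v i / fst q i) (at 0)"
        if "i \<in> V" for i
        unfolding line using q that by (auto intro!: derivative_eq_intros simp: U_def)
      have "((\<lambda>\<tau>. gaussian_bethe V E \<l> c (q + \<tau> *\<^sub>R v)) has_real_derivative D q v + 0) (at 0)"
        unfolding gaussian_bethe_def D_def
        by (intro DERIV_add DERIV_diff DERIV_cmult DERIV_sum DERIV_const l d e)
      then show ?thesis by simp
    qed
    show "((\<lambda>\<tau>. D (\<eta> + \<tau> *\<^sub>R w) v) has_real_derivative Q w v) (at 0)" for v w
    proof -
      have d: "((\<lambda>\<tau>. dd (\<eta> + \<tau> *\<^sub>R w) v \<alpha> / edge_det (\<eta> + \<tau> *\<^sub>R w) \<alpha>) has_real_derivative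
          dd w v \<alpha> / edge_det \<eta> \<alpha> - dd \<eta> w \<alpha> * dd \<eta> v \<alpha> / (edge_det \<eta> \<alpha>)\<^sup>2) (at 0)"
        if \<alpha>: "\<alpha> \<in> E" for \<alpha>
      proof -
        have nz: "edge_det \<eta> \<alpha> \<noteq> 0" using det[OF \<alpha>] by (simp add: det_eq[OF \<alpha>] \<eta>_eq)
        have "((\<lambda>\<tau>. dd (\<eta> + \<tau> *\<^sub>R w) v \<alpha>) has_real_derivative dd w v \<alpha>) (at 0)"
          unfolding dd_def line by (auto intro!: derivative_eq_intros)
        from DERIV_divide[OF this det_deriv[OF \<alpha>, of \<eta> w]] nz show ?thesis
          by (simp add: diff_divide_distrib power2_eq_square mult.commute)
      qed
      have e: "((\<lambda>\<tau>. fst v i / fst (\<eta> + \<tau> *\<^sub>R w) i) has_real_derivative - fst w i * fst v i / (vr i)\<^sup>2) (at 0)"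
        if "i \<in> V" for i
        unfolding line using vr[OF that] 
        by (auto intro!: derivative_eq_intros simp: \<eta>_eq power2_eq_square)
      have "((\<lambda>\<tau>. D (\<eta> + \<tau> *\<^sub>R w) v) has_real_derivative
         0 - (1/2) * (\<Sum>\<alpha>\<in>E. dd w v \<alpha> / edge_det \<eta> \<alpha> - dd \<eta> w \<alpha> * dd \<eta> v \<alpha> / (edge_det \<eta> \<alpha>)\<^sup>2)
         - (1/2) * (\<Sum>i\<in>V. (1 - real (hdegree E i)) * (- fst w i * fst v i / (vr i)\<^sup>2))) (at 0)"
        unfolding D_def
        by (intro DERIV_diff DERIV_cmult DERIV_sum DERIV_const d e)
      then show ?thesis by (simp add: Q_def)
    qed
    show "linear (Q w)" for w
    proof (rule linearI)
      have dd_add: "dd q (u + v) \<alpha> = dd q u \<alpha> + dd q v \<alpha>" and dd_scale: "dd q (s *\<^sub>R v) \<alpha> = s * dd q v \<alpha>"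
        for q u v s \<alpha>
        by (simp_all add: dd_def scaleR_fun_def algebra_simps)
      show "Q w (u + v) = Q w u + Q w v" for u v
        unfolding Q_def dd_add
        by (simp add: sum.distrib sum_subtractf algebra_simps add_divide_distrib diff_divide_distrib)
      show "Q w (s *\<^sub>R v) = s *\<^sub>R Q w v" for s v
        unfolding Q_def dd_scale
        by (simp add: scaleR_fun_def sum_distrib_left algebra_simps diff_divide_distrib sum_subtractf)
    qed
    show "Q v w = Q w v" for v w
      unfolding Q_def dd_def by (simp add: mult_ac add_ac)
    show "Q h h > 0" if hT: "h \<in> T" and h0: "h \<noteq> 0" for h
    proof -
      define ef where "ef = (\<lambda>\<alpha>. edge_form (vr (e1 \<alpha>)) (vr (e2 \<alpha>)) (cv \<alpha>) (fst h (e1 \<alpha>)) (fst h (e2 \<alpha>)) (snd h \<alpha>)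
          / (2 * (vr (e1 \<alpha>) * vr (e2 \<alpha>) - (cv \<alpha>)\<^sup>2)\<^sup>2))"
      have Qh: "Q h h = (\<Sum>\<alpha>\<in>E. ef \<alpha>)
          + (\<Sum>i\<in>V. (1 - real (hdegree E i)) * ((fst h i)\<^sup>2 / (2 * (vr i)\<^sup>2)))"
      proof -
        have "ef \<alpha> = - (1/2) * (dd h h \<alpha> / edge_det \<eta> \<alpha> - dd \<eta> h \<alpha> * dd \<eta> h \<alpha> / (edge_det \<eta> \<alpha>)\<^sup>2)"
          if \<alpha>: "\<alpha> \<in> E" for \<alpha>
        proof -
          define \<Delta> where "\<Delta> = vr (e1 \<alpha>) * vr (e2 \<alpha>) - (cv \<alpha>)\<^sup>2"
          have "\<Delta> > 0" using det[OF \<alpha>] by (simp add: \<Delta>_def)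
          then show ?thesis
            unfolding ef_def edge_form_def det_eq[OF \<alpha>] \<eta>_eq fst_conv snd_conv \<Delta>_def[symmetric] dd_def
            by (simp add: field_simps power2_eq_square)
        qed
        then show ?thesis
          unfolding Q_def by (simp add: sum_distrib_left sum_negf[symmetric] power2_eq_square)
      qed
      have ef_nonneg: "ef \<alpha> \<ge> 0" if "\<alpha> \<in> E" for \<alpha>
        unfolding ef_def by (intro divide_nonneg_nonneg edge_form_nonneg vr eV det that) simp
      show ?thesis
      \<comment> \<open>When no variance moves, some edge covariance does, and the edge terms alone
        are positive.\<close>
      proof (cases "\<exists>i\<in>V. fst h i \<noteq> 0")
        case False
        then have hV: "fst h = (\<lambda>i. 0)" using hT by (auto simp: T_def fun_eq_iff)
        then have "\<exists>\<alpha>. snd h \<alpha> \<noteq> 0" using h0 by (cases h) (auto simp: zero_prod_def zero_fun_def)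
        then obtain \<alpha> where \<alpha>: "\<alpha> \<in> E" "snd h \<alpha> \<noteq> 0" using hT by (auto simp: T_def)
        have "ef \<alpha> > 0"
          using edge_form_pos[OF det[OF \<alpha>(1)] \<alpha>(2)] det[OF \<alpha>(1)] by (simp add: ef_def hV)
        then have "(\<Sum>\<alpha>\<in>E. ef \<alpha>) > 0" using \<alpha>(1) ef_nonneg by (intro sum_pos2[OF finE])
        then show ?thesis unfolding Qh by (simp add: hV)
      next
        case True
        then obtain i0 where i0: "i0 \<in> V" "fst h i0 \<noteq> 0" by blast
        define r where "r = (gaussian_dim :: 'v \<Rightarrow> nat)"
        have r: "r i = 1" for i by (simp add: r_def gaussian_dim_def)
        define Var where "Var = (\<lambda>j (k::nat) (l::nat). cov (normal_measure (\<mu> j) (vr j)) (gaussian_phi \<mu> j) (gaussian_phi \<mu> j))"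
        define C where "C = (\<lambda>\<alpha> j i (k::nat) (l::nat). cov (normal2_measure (\<mu> j) (\<mu> i) (vr j) (cv \<alpha>) (vr i))
                      (\<lambda>(x, y). gaussian_phi \<mu> j x) (\<lambda>(x, y). gaussian_phi \<mu> i y))"
        \<comment> \<open>Twice the entrywise square of the edge covariance matrix. Unlike in the
          multinomial case \<open>K\<close> is not read off from \<open>C\<close>: with equal ends
          \<open>C\<close> would use \<open>cv \<alpha>\<close> as the covariance of a vertex with
          itself.\<close>
        define K where "K = (\<lambda>\<alpha> p q. if fst (p :: 'v \<times> nat) = fst (q :: 'v \<times> nat) then 2 * (vr (fst p))\<^sup>2 else 2 * (cv \<alpha>)\<^sup>2)"
        have u: "gaussian_u \<mu> \<eta> = edge_weights r Var C"
          by (simp add: gaussian_u_def \<eta>_eq r_def Var_def C_def)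
        have Var_eq: "Var i k l = 2 * (vr i)\<^sup>2" if "i \<in> V" for i k l
          unfolding Var_def gaussian_phi_def using cov_normal_squares[OF vr[OF that]] .
        have C_eq: "C \<alpha> i j k l = 2 * (cv \<alpha>)\<^sup>2" if "\<alpha> \<in> E" "i \<in> \<alpha>" "j \<in> \<alpha>" "i \<noteq> j" for \<alpha> i j k l
        proof -
          have mem: "k = e1 \<alpha> \<or> k = e2 \<alpha>" if "k \<in> \<alpha>" for k
            using that by (subst (asm) e12(1)[OF \<open>\<alpha> \<in> E\<close>]) simp
          have ij: "i = e1 \<alpha> \<and> j = e2 \<alpha> \<or> i = e2 \<alpha> \<and> j = e1 \<alpha>"
            using mem[of i] mem[of j] that by blast
          then have "vr i * vr j - (cv \<alpha>)\<^sup>2 > 0" "vr i > 0"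
            using det[OF that(1)] vr eV[OF that(1)] by (auto simp: mult.commute)
          then show ?thesis unfolding C_def gaussian_phi_def by (intro cov_normal2_squares)
        qed
        have quadK: "quad (SIGMA i:\<alpha>. {1..r i}) (K \<alpha>) a a
            = 2 * (vr (e1 \<alpha>))\<^sup>2 * (a (e1 \<alpha>, 1))\<^sup>2 + 4 * (cv \<alpha>)\<^sup>2 * a (e1 \<alpha>, 1) * a (e2 \<alpha>, 1)
              + 2 * (vr (e2 \<alpha>))\<^sup>2 * (a (e2 \<alpha>, 1))\<^sup>2" if \<alpha>: "\<alpha> \<in> E" for \<alpha> a
        proof -
          have "finite \<alpha>" using card2[OF \<alpha>] by (metis card.infinite zero_neq_numeral)
          then have sumJ: "sum f (SIGMA i:\<alpha>. {1..r i}) = f (e1 \<alpha>, 1) + f (e2 \<alpha>, 1)"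
            for f :: "'v \<times> nat \<Rightarrow> real"
            by (simp only: sum_indexed sum_edge[OF \<alpha>] r) simp
          show ?thesis
            using e12(2)[OF \<alpha>] unfolding quad_def sumJ
            by (simp add: K_def power2_eq_square algebra_simps)
        qed
        \<comment> \<open>With one statistic per vertex the inverse of \<open>Var i\<close> is
          division by \<open>2 (vr i)\<^sup>2\<close>, which fixes the vector \<open>g\<close> of
          the reduced form.\<close>
        have "\<exists>a. (\<Sum>\<alpha>\<in>E. 2 * (\<Sum>i\<in>\<alpha>. \<Sum>k=1..r i. a \<alpha> (i, k) * fst h i)
                  - quad (SIGMA i:\<alpha>. {1..r i}) (K \<alpha>) (a \<alpha>) (a \<alpha>))
            + (\<Sum>i\<in>V. (1 - real (hdegree E i)) * (\<Sum>k=1..r i. fst h i / (2 * (vr i)\<^sup>2) * fst h i)) > 0"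
        proof (rule reduced_bethe_form_pos[OF finV EV, where Var = Var and C = C])
          fix i assume i: "i \<in> V"
          show "pd_on {1..r i} (Var i)"
          proof (rule pd_onI)
            show "Var i k l = Var i l k" for k l by (simp add: Var_eq[OF i])
            fix x :: "nat \<Rightarrow> real" and k assume "k \<in> {1..r i}" "x k \<noteq> 0"
            then have "x 1 \<noteq> 0" by (simp add: r)
            moreover have "quad {1..r i} (Var i) x x = 2 * (vr i * x 1)\<^sup>2"
              by (simp add: quad_def r Var_eq[OF i] power2_eq_square)
            ultimately show "quad {1..r i} (Var i) x x > 0" using vr[OF i] by simp
          qed
          show "(\<Sum>l=1..r i. Var i k l * (fst h i / (2 * (vr i)\<^sup>2))) = fst h i" for k
            using vr[OF i] by (simp add: r Var_eq[OF i])
        next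
          fix \<alpha> assume \<alpha>: "\<alpha> \<in> E"
          show "pd_on (SIGMA i:\<alpha>. {1..r i}) (K \<alpha>)"
          proof (rule pd_onI)
            show "K \<alpha> p q = K \<alpha> q p" for p q by (simp add: K_def)
            fix a :: "'v \<times> nat \<Rightarrow> real" and p assume "p \<in> (SIGMA i:\<alpha>. {1..r i})" "a p \<noteq> 0"
            then have "a (e1 \<alpha>, 1) \<noteq> 0 \<or> a (e2 \<alpha>, 1) \<noteq> 0"
              by (subst (asm) e12(1)[OF \<alpha>]) (auto simp: r)
            then show "quad (SIGMA i:\<alpha>. {1..r i}) (K \<alpha>) a a > 0"
              unfolding quadK[OF \<alpha>] by (intro gaussian_edge_pd vr eV det \<alpha>)
          qed
          show "K \<alpha> (i, k) (i, l) = Var i k l" if "i \<in> \<alpha>" for i k l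
            using that \<alpha> EV by (subst Var_eq) (auto simp: K_def)
          show "K \<alpha> (i, k) (j, l) = C \<alpha> i j k l" if "i \<in> \<alpha>" "j \<in> \<alpha>" "i \<noteq> j" for i j k l
            using that by (simp add: C_eq[OF \<alpha>] K_def)
        next
          show "z \<notin> complex_of_real ` {1..}" if "edge_op_eigenvalue E r (edge_weights r Var C) z" for z
            using eig that by (simp add: u r_def)
          show "i0 \<in> V" "(1::nat) \<in> {1..r i0}" "fst h i0 \<noteq> 0" using i0 by (auto simp: r)
        qed
        then obtain a where a: "(\<Sum>\<alpha>\<in>E. 2 * (\<Sum>i\<in>\<alpha>. \<Sum>k=1..r i. a \<alpha> (i, k) * fst h i)
                  - quad (SIGMA i:\<alpha>. {1..r i}) (K \<alpha>) (a \<alpha>) (a \<alpha>))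
            + (\<Sum>i\<in>V. (1 - real (hdegree E i)) * (\<Sum>k=1..r i. fst h i / (2 * (vr i)\<^sup>2) * fst h i)) > 0"
          by blast
        have "(\<Sum>\<alpha>\<in>E. 2 * (\<Sum>i\<in>\<alpha>. \<Sum>k=1..r i. a \<alpha> (i, k) * fst h i)
                  - quad (SIGMA i:\<alpha>. {1..r i}) (K \<alpha>) (a \<alpha>) (a \<alpha>))
            + (\<Sum>i\<in>V. (1 - real (hdegree E i)) * (\<Sum>k=1..r i. fst h i / (2 * (vr i)\<^sup>2) * fst h i)) \<le> Q h h"
          unfolding Qh
        proof (intro add_mono sum_mono)
          fix \<alpha> assume \<alpha>: "\<alpha> \<in> E"
          show "2 * (\<Sum>i\<in>\<alpha>. \<Sum>k=1..r i. a \<alpha> (i, k) * fst h i)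
                  - quad (SIGMA i:\<alpha>. {1..r i}) (K \<alpha>) (a \<alpha>) (a \<alpha>) \<le> ef \<alpha>"
            unfolding quadK[OF \<alpha>] ef_def
            using edge_form_lower_bound[OF vr[OF eV(1)[OF \<alpha>]] det[OF \<alpha>], of "a \<alpha> (e1 \<alpha>, 1)" "fst h (e1 \<alpha>)"
                "a \<alpha> (e2 \<alpha>, 1)" "fst h (e2 \<alpha>)" "snd h \<alpha>"]
            by (simp add: r sum_edge[OF \<alpha>])
        qed (simp add: r power2_eq_square)
        then show ?thesis using a by linarith
      qed
    qed
  qed
qed

theorem theorem4p6:
  fixes V :: "'v set"
  shows
    "(\<forall>(F :: 'v set set) (N :: 'v \<Rightarrow> nat) (\<Psi> :: 'v set \<Rightarrow> ('v \<Rightarrow> nat) \<Rightarrow> real)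
        (\<eta> :: 'v multinomial_point).
        hypergraph V F \<and> (\<forall>i\<in>V. N i \<ge> 1) \<and> (\<forall>\<alpha>\<in>F. \<forall>x\<in>states N \<alpha>. \<Psi> \<alpha> x > 0) \<and>
        \<eta> \<in> multinomial_L V F N \<and>
        (\<forall>z. edge_op_eigenvalue F (multinomial_dim N) (multinomial_u N \<eta>) z \<longrightarrow>
             z \<notin> complex_of_real ` {1..})
        \<longrightarrow> hessian_positive_definite (multinomial_L V F N) (multinomial_bethe V F N \<Psi>) \<eta>) \<and>
     (\<forall>(E :: 'v set set) (\<mu> :: 'v \<Rightarrow> real) (\<l> :: 'v gaussian_point \<Rightarrow> real) (c :: real)
        (\<eta> :: 'v gaussian_point).
        simple_graph V E \<and> linear \<l> \<and> \<eta> \<in> gaussian_L V E \<and>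
        (\<forall>z. edge_op_eigenvalue E gaussian_dim (gaussian_u \<mu> \<eta>) z \<longrightarrow>
             z \<notin> complex_of_real ` {1..})
        \<longrightarrow> hessian_positive_definite (gaussian_L V E) (gaussian_bethe V E \<l> c) \<eta>)"
  by (intro conjI allI impI, blast intro: multinomial_hessian_positive_definite, blast intro: gaussian_hessian_positive_definite)

end
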